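(* Let $\mathbb{K}$ be an algebraically closed field of characteristic zero and let $A=\mathbb{K}_Q[x_1,x_2,x_3,x_4]$ be the quantum polynomial algebra associated with a generic parameter matrix $Q=(q_{ij})$. Then the Kodaira–Spencer map $T_QS\to \mathrm{HH}^2_0(A)$ associated to the family $\{\mathbb{K}_{Q'}[x_1,x_2,x_3,x_4]\}_{Q'\in S}$, $S=(\mathbb{K}^\times)^6$ with coordinates $q_{ij}$ $(1\le i<j\le4)$, is both injective and surjective.
   Context: For $q_{ij}\in\mathbb{K}^\times$ ($1\le i<j\le 4$) put $q_{ii}=1$, $q_{ji}=q_{ij}^{-1}$, $Q=(q_{ij})$. $\mathbb{K}_Q[x_1,\dots,x_4]$ is the free algebra $\mathbb{K}\langle x_1,\dots,x_4\rangle$ modulo the relations $x_jx_i-q_{ij}x_ix_j$, $1\le i<j\le4$, with each $x_i$ in degree 1. $Q$ is **generic** if: $q_{ij}\ne0$ for $i<j$; $q_{ij}q_{ik}\ne q_{i\ell}$ for all $j<k$ and $i\le\ell$ with $\{j,k\}\cap\{i,\ell\}=\emptyset$; and for all pairwise distinct $i,j,k,\ell$, the three equalities $q_{i\ell}=q_{ik}$, $q_{j\ell}=q_{jk}$, $q_{k\ell}=q_{kk}$ do not all hold. $\mathrm{HH}^2_0(A)$ is the degree-2 cohomology of the subcomplex of degree-preserving maps in the Hochschild cochain complex $\mathrm{Hom}_{\mathbb{K}}(A^{\otimes n},A)$; it classifies graded first-order deformations of $A$. The Kodaira–Spencer map sends a tangent vector $(\alpha_{ij})_{i<j}\in\mathbb{K}^6=T_QS$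 to the class of the first-order deformation over $\mathbb{K}[\varepsilon]/(\varepsilon^2)$ with relations $x_jx_i-(q_{ij}+\varepsilon\alpha_{ij})x_ix_j$. *)

theory Defs
  imports
    "HOL-Library.Poly_Mapping"
    "HOL-Library.Numeral_Type"
    "HOL-Library.FuncSet"
    "HOL-Computational_Algebra.Polynomial"
    "HOL-Algebra.QuotRing"
    "HOL-Algebra.Module"
begin

section \<open>Dual numbers\<close>

text \<open>\<open>Dual a b\<close> stands for \<open>a + b \<epsilon>\<close> in \<open>K[\<epsilon>]/(\<epsilon>\<^sup>2)\<close>.\<close>

datatype 'a dual = Dual (std_part: 'a) (eps_part: 'a)

instantiation dual :: (comm_ring_1) comm_ring_1
begin

definition "0 = Dual 0 0"
definition "1 = Dual 1 0"
definition "x + y = Dual (std_part x + std_part y) (eps_part x + eps_part y)"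
definition "- x = Dual (- std_part x) (- eps_part x)"
definition "x - y = Dual (std_part x - std_part y) (eps_part x - eps_part y)" for x y :: "'a dual"
definition "x * y = Dual (std_part x * std_part y)
  (std_part x * eps_part y + eps_part x * std_part y)"

instance
  by standard
    (simp_all add: zero_dual_def one_dual_def plus_dual_def uminus_dual_def minus_dual_def
      times_dual_def algebra_simps)

end

section \<open>Free algebras\<close>

text \<open>Words form the free monoid, written additively, so that the convolution product of
  \<^theory>\<open>HOL-Library.Poly_Mapping\<close> makes \<open>'n word \<Rightarrow>\<^sub>0 'r\<close> the free \<open>'r\<close>-algebra on \<open>'n\<close>.\<close>

datatype 'n word = Word (letters: "'n list")

instantiation word :: (type) monoid_add
begin

definition "0 = Word []"
definition "u + v = Word (letters u @ letters v)"

instance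
  by standard (simp_all add: zero_word_def plus_word_def)

end

definition var :: "'n \<Rightarrow> ('n word \<Rightarrow>\<^sub>0 'r::comm_ring_1)"
  where "var i = Poly_Mapping.single (Word [i]) 1"

definition const :: "'r \<Rightarrow> ('n word \<Rightarrow>\<^sub>0 'r::comm_ring_1)"
  where "const c = Poly_Mapping.single 0 c"

definition homogeneous :: "nat \<Rightarrow> ('n word \<Rightarrow>\<^sub>0 'r::comm_ring_1) \<Rightarrow> bool"
  where "homogeneous d p \<longleftrightarrow> (\<forall>w\<in>Poly_Mapping.keys p. length (letters w) = d)"

definition free_alg :: "('n word \<Rightarrow>\<^sub>0 'r::comm_ring_1) ring"
  where "free_alg = \<lparr>carrier = UNIV, mult = (*), one = 1, zero = 0, add = (+)\<rparr>"

section \<open>Graded algebras and quantum polynomial algebras\<close>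

text \<open>The scalars form a type \<open>'r\<close>; \<open>grade A d\<close> is the homogeneous component of degree \<open>d\<close>,
  zero included.\<close>

record ('r, 'a) graded_algebra = "('r, 'a) module" +
  grade :: "nat \<Rightarrow> 'a set"

definition graded_alg_iso ::
    "('r, 'a) graded_algebra \<Rightarrow> ('r, 'b) graded_algebra \<Rightarrow> ('a \<Rightarrow> 'b) set"
  where "graded_alg_iso A B = {\<phi> \<in> ring_iso A B.
    (\<forall>c. \<forall>x\<in>carrier A. \<phi> (c \<odot>\<^bsub>A\<^esub> x) = c \<odot>\<^bsub>B\<^esub> \<phi> x) \<and> (\<forall>d. \<phi> ` grade A d = grade B d)}"

text \<open>A parameter \<open>q\<close> only matters at the pairs \<open>(i, j)\<close> with \<open>i < j\<close>.\<close>

definition index_pairs :: "('n::linorder \<times> 'n) set"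
  where "index_pairs = {(i, j). i < j}"

definition qrelations :: "('n::linorder \<times> 'n \<Rightarrow> 'r) \<Rightarrow> ('n word \<Rightarrow>\<^sub>0 'r::comm_ring_1) set"
  where "qrelations q = {var j * var i - const (q (i, j)) * var i * var j |i j. i < j}"

definition qideal :: "('n::linorder \<times> 'n \<Rightarrow> 'r) \<Rightarrow> ('n word \<Rightarrow>\<^sub>0 'r::comm_ring_1) set"
  where "qideal q = Idl\<^bsub>free_alg\<^esub> (qrelations q)"

definition qpoly ::
    "('n::linorder \<times> 'n \<Rightarrow> 'r) \<Rightarrow> ('r::comm_ring_1, ('n word \<Rightarrow>\<^sub>0 'r) set) graded_algebra"
  where "qpoly q =
    \<lparr>carrier = carrier (free_alg Quot qideal q),
     mult = mult (free_alg Quot qideal q),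
     one = one (free_alg Quot qideal q),
     zero = zero (free_alg Quot qideal q),
     add = add (free_alg Quot qideal q),
     smult = \<lambda>c X. (qideal q +>\<^bsub>free_alg\<^esub> const c) \<otimes>\<^bsub>free_alg Quot qideal q\<^esub> X,
     grade = \<lambda>d. {qideal q +>\<^bsub>free_alg\<^esub> p |p. homogeneous d p}\<rparr>"

section \<open>Parameters\<close>

definition parameter_space :: "('n::linorder \<times> 'n \<Rightarrow> 'k::field) set"
  where "parameter_space = index_pairs \<rightarrow>\<^sub>E (UNIV - {0})"

definition tangent_space :: "('n::linorder \<times> 'n \<Rightarrow> 'k::field) set"
  where "tangent_space = index_pairs \<rightarrow>\<^sub>E UNIV"

definition qmatrix :: "('n::linorder \<times> 'n \<Rightarrow> 'k::field) \<Rightarrow> 'n \<Rightarrow> 'n \<Rightarrow> 'k"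
  where "qmatrix q i j =
    (if i < j then q (i, j) else if i = j then 1 else inverse (q (j, i)))"

definition generic :: "('n::linorder \<Rightarrow> 'n \<Rightarrow> 'k::field) \<Rightarrow> bool"
  where "generic Q \<longleftrightarrow>
    (\<forall>i j. i < j \<longrightarrow> Q i j \<noteq> 0) \<and>
    (\<forall>i j k l. j < k \<and> i \<le> l \<and> {j, k} \<inter> {i, l} = {} \<longrightarrow> Q i j * Q i k \<noteq> Q i l) \<and>
    (\<forall>i j k l. distinct [i, j, k, l] \<longrightarrow>
      \<not> (Q i l = Q i k \<and> Q j l = Q j k \<and> Q k l = Q k k))"

section \<open>Hochschild cohomology\<close>

text \<open>Linear maps \<open>A\<^sup>\<otimes>\<^sup>n \<rightarrow> A\<close> are represented by multilinear maps on \<open>n\<close>-tuples, and these by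
  functions on lists of length \<open>n\<close> that are \<^const>\<open>undefined\<close> off the tuples.\<close>

definition tuples :: "('r, 'a) graded_algebra \<Rightarrow> nat \<Rightarrow> 'a list set"
  where "tuples A n = {xs. length xs = n \<and> set xs \<subseteq> carrier A}"

definition cochains :: "('r, 'a) graded_algebra \<Rightarrow> nat \<Rightarrow> ('a list \<Rightarrow> 'a) set"
  where "cochains A n = {f \<in> tuples A n \<rightarrow>\<^sub>E carrier A. \<forall>xs\<in>tuples A n. \<forall>i<n.
    (\<forall>a\<in>carrier A. \<forall>b\<in>carrier A. f (xs[i := a \<oplus>\<^bsub>A\<^esub> b]) = f (xs[i := a]) \<oplus>\<^bsub>A\<^esub> f (xs[i := b])) \<and>
    (\<forall>c. \<forall>a\<in>carrier A. f (xs[i := c \<odot>\<^bsub>A\<^esub> a]) = c \<odot>\<^bsub>A\<^esub> f (xs[i := a]))}"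

definition graded_cochains :: "('r, 'a) graded_algebra \<Rightarrow> nat \<Rightarrow> ('a list \<Rightarrow> 'a) set"
  where "graded_cochains A n = {f \<in> cochains A n. \<forall>ds xs.
    length ds = n \<and> length xs = n \<and> (\<forall>i<n. xs ! i \<in> grade A (ds ! i))
      \<longrightarrow> f xs \<in> grade A (sum_list ds)}"

definition hoch_diff ::
    "('r::comm_ring_1, 'a) graded_algebra \<Rightarrow> nat \<Rightarrow> ('a list \<Rightarrow> 'a) \<Rightarrow> 'a list \<Rightarrow> 'a"
  where "hoch_diff A n f = (\<lambda>xs\<in>tuples A (Suc n).
    (hd xs \<otimes>\<^bsub>A\<^esub> f (tl xs))
    \<oplus>\<^bsub>A\<^esub> (\<Oplus>\<^bsub>A\<^esub>i\<in>{..<n}. (- 1) ^ Suc i \<odot>\<^bsub>A\<^esub>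
          f (take i xs @ (xs ! i \<otimes>\<^bsub>A\<^esub> xs ! Suc i) # drop (i + 2) xs))
    \<oplus>\<^bsub>A\<^esub> ((- 1) ^ Suc n \<odot>\<^bsub>A\<^esub> (f (butlast xs) \<otimes>\<^bsub>A\<^esub> last xs)))"

definition graded_cocycles ::
    "('r::comm_ring_1, 'a) graded_algebra \<Rightarrow> nat \<Rightarrow> ('a list \<Rightarrow> 'a) set"
  where "graded_cocycles A n =
    {f \<in> graded_cochains A n. hoch_diff A n f = (\<lambda>xs\<in>tuples A (Suc n). \<zero>\<^bsub>A\<^esub>)}"

definition graded_coboundaries ::
    "('r::comm_ring_1, 'a) graded_algebra \<Rightarrow> nat \<Rightarrow> ('a list \<Rightarrow> 'a) set"
  where "graded_coboundaries A n = (case n of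
      0 \<Rightarrow> {\<lambda>xs\<in>tuples A 0. \<zero>\<^bsub>A\<^esub>}
    | Suc m \<Rightarrow> hoch_diff A m ` graded_cochains A m)"

definition cocycle_group :: "('r::comm_ring_1, 'a) graded_algebra \<Rightarrow> nat \<Rightarrow> ('a list \<Rightarrow> 'a) monoid"
  where "cocycle_group A n =
    \<lparr>carrier = graded_cocycles A n,
     mult = \<lambda>f g. \<lambda>xs\<in>tuples A n. f xs \<oplus>\<^bsub>A\<^esub> g xs,
     one = \<lambda>xs\<in>tuples A n. \<zero>\<^bsub>A\<^esub>\<rparr>"

definition HH_graded ::
    "('r::comm_ring_1, 'a) graded_algebra \<Rightarrow> nat \<Rightarrow> ('a list \<Rightarrow> 'a) set monoid"
  where "HH_graded A n = cocycle_group A n Mod graded_coboundaries A n"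

section \<open>First-order deformations and the Kodaira--Spencer map\<close>

text \<open>The first-order deformation of \<open>A\<close> given by a 2-cocycle \<open>f\<close>: the \<open>K[\<epsilon>]/(\<epsilon>\<^sup>2)\<close>-module
  \<open>A \<oplus> A \<epsilon>\<close> with \<open>a * b = a b + f(a, b) \<epsilon>\<close> for \<open>a\<close>, \<open>b\<close> in \<open>A\<close>. Its unit is \<open>1 - f(1, 1) \<epsilon>\<close>,
  since \<open>f\<close> need not be normalised.\<close>

definition deformation ::
    "('k::comm_ring_1, 'a) graded_algebra \<Rightarrow> ('a list \<Rightarrow> 'a) \<Rightarrow> ('k dual, 'a \<times> 'a) graded_algebra"
  where "deformation A f =
    \<lparr>carrier = carrier A \<times> carrier A,
     mult = \<lambda>(a, a') (b, b').
       (a \<otimes>\<^bsub>A\<^esub> b, (a \<otimes>\<^bsub>A\<^esub> b') \<oplus>\<^bsub>A\<^esub> (a' \<otimes>\<^bsub>A\<^esub> b) \<oplus>\<^bsub>A\<^esub> f [a, b]),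
     one = (\<one>\<^bsub>A\<^esub>, \<ominus>\<^bsub>A\<^esub> f [\<one>\<^bsub>A\<^esub>, \<one>\<^bsub>A\<^esub>]),
     zero = (\<zero>\<^bsub>A\<^esub>, \<zero>\<^bsub>A\<^esub>),
     add = \<lambda>(a, a') (b, b'). (a \<oplus>\<^bsub>A\<^esub> b, a' \<oplus>\<^bsub>A\<^esub> b'),
     smult = \<lambda>c (a, a'). (std_part c \<odot>\<^bsub>A\<^esub> a,
       (std_part c \<odot>\<^bsub>A\<^esub> a') \<oplus>\<^bsub>A\<^esub> (eps_part c \<odot>\<^bsub>A\<^esub> a)),
     grade = \<lambda>d. grade A d \<times> grade A d\<rparr>"

text \<open>The algebra over the dual numbers with relations
  \<open>x\<^sub>j x\<^sub>i - (q\<^sub>i\<^sub>j + \<epsilon> \<alpha>\<^sub>i\<^sub>j) x\<^sub>i x\<^sub>j\<close>, and its reduction modulo \<open>\<epsilon>\<close> to \<open>qpoly q\<close>. On a coset, the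
  reduction applies \<^const>\<open>std_part\<close> to the coefficients of all representatives; the result is
  a coset of \<open>qideal q\<close>, because the ideal upstairs maps onto \<open>qideal q\<close>.\<close>

definition qpoly_eps ::
    "('n::linorder \<times> 'n \<Rightarrow> 'k) \<Rightarrow> ('n \<times> 'n \<Rightarrow> 'k)
      \<Rightarrow> ('k::comm_ring_1 dual, ('n word \<Rightarrow>\<^sub>0 'k dual) set) graded_algebra"
  where "qpoly_eps q \<alpha> = qpoly (\<lambda>ij. Dual (q ij) (\<alpha> ij))"

definition reduce_eps :: "('n word \<Rightarrow>\<^sub>0 'k::comm_ring_1 dual) set \<Rightarrow> ('n word \<Rightarrow>\<^sub>0 'k) set"
  where "reduce_eps X = Poly_Mapping.map std_part ` X"

text \<open>The class of a first-order deformation, as a coset of coboundaries, consists of all cocycles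
  whose deformation is isomorphic to it by a graded \<open>K[\<epsilon>]/(\<epsilon>\<^sup>2)\<close>-algebra isomorphism that is
  the identity modulo \<open>\<epsilon>\<close>.\<close>

definition kodaira_spencer ::
    "('n::linorder \<times> 'n \<Rightarrow> 'k) \<Rightarrow> ('n \<times> 'n \<Rightarrow> 'k)
      \<Rightarrow> (('n word \<Rightarrow>\<^sub>0 'k::field) set list \<Rightarrow> ('n word \<Rightarrow>\<^sub>0 'k) set) set"
  where "kodaira_spencer q \<alpha> = {f \<in> graded_cocycles (qpoly q) 2.
    \<exists>\<phi>\<in>graded_alg_iso (deformation (qpoly q) f) (qpoly_eps q \<alpha>).
      \<forall>a\<in>carrier (qpoly q). \<forall>a'\<in>carrier (qpoly q). reduce_eps (\<phi> (a, a')) = a}"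

end

(* Ordered monomials form a basis of the quantum polynomial algebra over any commutative ring, so the
   algebra is a monoid algebra twisted by a bicharacter, and over the dual numbers the derivative of
   the bicharacter in the direction alpha is an explicit 2-cocycle representing the Kodaira--Spencer
   class of alpha. A graded 2-cocycle F is determined up to coboundary by its obstructions
   r_ij = F(x_j, x_i) - q_ij F(x_i, x_j): when they vanish, x_i |-> x_i extends to an algebra
   homomorphism into the deformation by F, whose epsilon-part is the cochain needed. Resolving the
   overlap x_k x_j x_i gives linear equations for the coefficients of the r_ij. Genericity forces the
   coefficients of monomials containing neither x_i nor x_j to vanish, and those of x_i x_a with
   a /= j to come from a substitution x_j |-> x_j + t x_a epsilon; only multiples of x_i x_j remain,
   and these are the six parameters. *)

theory Submission
  imports Defs
begin

section \<open>Linear algebra with bases\<close>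

text \<open>The normal-form lemmas ask only for a commutative ring of scalars because they are used
  twice, over K and over K[\<epsilon>]; freeness of the deformed algebra over K[\<epsilon>] then
  needs no separate argument. The basis needs no confluence check: a bicharacter is a 2-cocycle on
  the monoid of exponents, so the twisted product is associative outright, and the free algebra maps
  onto it by counting inversions.

  The overlap equations separate by monomial. For a monomial x_a x_b in r_ij avoiding x_i and x_j,
  only r_ij itself survives, and the condition q_ai q_aj /= q_ab says that its scalar factor is
  nonzero. For x_i x_a in r_ij the equations only compare different i for fixed j and a; if q_kj =
  q_ka held for all k /= j, they would read 0 = 0. The last genericity condition excludes this,
  which leaves one free parameter, filled by the substitution. This is the only place where the
  number four enters: there are two indices besides a and j.

  Injectivity comes from the remaining coefficient: a coboundary cannot change the coefficient of
  x_i x_j in r_ij, so \<alpha> can be read off from the class.\<close>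

abbreviation lookup :: "('a \<Rightarrow>\<^sub>0 'r::zero) \<Rightarrow> 'a \<Rightarrow> 'r"
  where "lookup \<equiv> Poly_Mapping.lookup"

abbreviation keys :: "('a \<Rightarrow>\<^sub>0 'r::zero) \<Rightarrow> 'a set"
  where "keys \<equiv> Poly_Mapping.keys"

abbreviation single :: "'a \<Rightarrow> 'r \<Rightarrow> ('a \<Rightarrow>\<^sub>0 'r::zero)"
  where "single \<equiv> Poly_Mapping.single"

definition scal :: "'r \<Rightarrow> ('a \<Rightarrow>\<^sub>0 'r::comm_ring_1) \<Rightarrow> ('a \<Rightarrow>\<^sub>0 'r)"
  where "scal c x = Poly_Mapping.map ((*) c) x"

text \<open>\<open>Poly_Mapping.map\<close> keeps absent keys absent, so it acts coefficientwise
  only for functions fixing 0.\<close>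

lemma lookup_map0:
  assumes "f 0 = 0"
  shows "lookup (Poly_Mapping.map f x) k = f (lookup x k)"
  using assms by (auto simp: Poly_Mapping.map.rep_eq when_def)

lemma lookup_scal [simp]: "lookup (scal c x) k = c * lookup x k"
  by (simp add: scal_def lookup_map0)

lemma scal_add_right: "scal c (x + y) = scal c x + scal c y"
  and scal_add_left: "scal (c + d) x = scal c x + scal d x"
  and scal_diff_right: "scal c (x - y) = scal c x - scal c y"
  and scal_minus_right: "scal c (- x) = - scal c x"
  and scal_minus_left: "scal (- c) x = - scal c x"
  and scal_scal [simp]: "scal c (scal d x) = scal (c * d) x"
  and scal_single [simp]: "scal c (single a d) = single a (c * d)"
  and scal_one [simp]: "scal 1 x = x"
  and scal_zero_left [simp]: "scal 0 x = 0"
  and scal_zero_right [simp]: "scal c 0 = 0"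
  by (rule poly_mapping_eqI;
      simp add: lookup_add lookup_minus lookup_single when_def algebra_simps)+

definition klinear :: "(('a \<Rightarrow>\<^sub>0 'r::comm_ring_1) \<Rightarrow> ('b \<Rightarrow>\<^sub>0 'r)) \<Rightarrow> bool"
  where "klinear f \<longleftrightarrow> (\<forall>x y. f (x + y) = f x + f y) \<and> (\<forall>c x. f (scal c x) = scal c (f x))"

lemma klinearI:
  "(\<And>x y. f (x + y) = f x + f y) \<Longrightarrow> (\<And>c x. f (scal c x) = scal c (f x)) \<Longrightarrow> klinear f"
  by (simp add: klinear_def)

lemma klinear_add: "klinear f \<Longrightarrow> f (x + y) = f x + f y"
  and klinear_scal: "klinear f \<Longrightarrow> f (scal c x) = scal c (f x)"
  by (simp_all add: klinear_def)

lemma klinear_zero: "klinear f \<Longrightarrow> f 0 = 0"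
  using klinear_add[of f 0 0] by simp

lemma klinear_minus: "klinear f \<Longrightarrow> f (- x) = - f x"
  using klinear_scal[of f "-1" x] by (simp add: scal_minus_left)

lemma klinear_diff: "klinear f \<Longrightarrow> f (x - y) = f x - f y"
  using klinear_add[of f x "- y"] by (simp add: klinear_minus)

lemma klinear_id: "klinear (\<lambda>x. x)"
  by (simp add: klinear_def)

lemma klinear_compose: "klinear f \<Longrightarrow> klinear g \<Longrightarrow> klinear (\<lambda>x. f (g x))"
  by (simp add: klinear_def)

lemma klinear_plus: "klinear f \<Longrightarrow> klinear g \<Longrightarrow> klinear (\<lambda>x. f x + g x)"
  by (simp add: klinear_def scal_add_right)

lemma klinear_uminus: "klinear f \<Longrightarrow> klinear (\<lambda>x. - f x)"
  by (simp add: klinear_def scal_minus_right)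

lemma klinear_subtract: "klinear f \<Longrightarrow> klinear g \<Longrightarrow> klinear (\<lambda>x. f x - g x)"
  by (simp add: klinear_def scal_diff_right)

lemma klinear_scaled: "klinear f \<Longrightarrow> klinear (\<lambda>x. scal c (f x))"
  by (simp add: klinear_def scal_add_right mult.commute)

lemma poly_mapping_add_induct [case_names zero single add]:
  fixes x :: "'a \<Rightarrow>\<^sub>0 'r::comm_ring_1"
  assumes "P 0" and single: "\<And>a c. P (single a c)"
    and plus: "\<And>x y. P x \<Longrightarrow> P y \<Longrightarrow> P (x + y)"
  shows "P x"
proof -
  have "P y" if "finite A" "keys y \<subseteq> A" for A and y :: "'a \<Rightarrow>\<^sub>0 'r"
    using that
  proof (induction A arbitrary: y rule: finite_induct)
    case empty
    then have "y = 0" by (auto simp: in_keys_iff intro!: poly_mapping_eqI)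
    then show ?case using \<open>P 0\<close> by simp
  next
    case (insert a A)
    let ?s = "single a (lookup y a)"
    have "keys (y - ?s) \<subseteq> A"
    proof
      fix k assume k: "k \<in> keys (y - ?s)"
      then have "k \<noteq> a" by (auto simp: in_keys_iff lookup_minus)
      then have "k \<in> keys y" using k by (auto simp: in_keys_iff lookup_minus lookup_single)
      with \<open>k \<noteq> a\<close> show "k \<in> A" using insert.prems by auto
    qed
    then have "P (y - ?s)" using insert.IH by blast
    then have "P ((y - ?s) + ?s)" using single plus by blast
    then show ?case by simp
  qed
  then show ?thesis using finite_keys by blast
qed

text \<open>Serves maps for which \<open>klinear\<close> makes no sense: \<open>stdp\<close> passes
  from K[\<epsilon>] to K, and coefficient functionals take scalar values. Cancellation in the
  target yields the value at 0.\<close>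

lemma additive_ext:
  fixes f g :: "('a \<Rightarrow>\<^sub>0 'r::comm_ring_1) \<Rightarrow> 'c::cancel_comm_monoid_add"
  assumes f: "\<And>x y. f (x + y) = f x + f y" and g: "\<And>x y. g (x + y) = g x + g y"
    and eq: "\<And>a c. f (single a c) = g (single a c)"
  shows "f x = g x"
proof (induction x rule: poly_mapping_add_induct)
  case zero
  show ?case using f[of 0 0] g[of 0 0] by simp
qed (simp_all add: f g eq)

lemma klinear_ext:
  assumes "klinear f" "klinear g"
    and "\<And>a. f (single a 1) = g (single a 1)"
  shows "f x = g x"
proof (rule additive_ext[where f = f and g = g and x = x])
  fix a c
  show "f (single a c) = g (single a c)"
    using assms klinear_scal[of f c "single a 1"]
      klinear_scal[of g c "single a 1"] by simp
qed (use assms in \<open>auto simp: klinear_add\<close>)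

lemma klinear_ext2:
  assumes "\<And>x. klinear (F x)" "\<And>x. klinear (G x)"
    and "\<And>y. klinear (\<lambda>x. F x y)" "\<And>y. klinear (\<lambda>x. G x y)"
    and "\<And>a b. F (single a 1) (single b 1)
      = G (single a 1) (single b 1)"
  shows "F x y = G x y"
proof (rule klinear_ext[where x = y])
  fix b
  show "F x (single b 1) = G x (single b 1)"
    by (rule klinear_ext[where x = x]) (use assms in auto)
qed (use assms in auto)

definition lin :: "('a \<Rightarrow> ('b \<Rightarrow>\<^sub>0 'r)) \<Rightarrow> ('a \<Rightarrow>\<^sub>0 'r::comm_ring_1) \<Rightarrow> ('b \<Rightarrow>\<^sub>0 'r)"
  where "lin \<phi> x = (\<Sum>a\<in>keys x. scal (lookup x a) (\<phi> a))"

lemma lin_superset: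
  assumes "finite A" "keys x \<subseteq> A"
  shows "lin \<phi> x = (\<Sum>a\<in>A. scal (lookup x a) (\<phi> a))"
  unfolding lin_def using assms by (intro sum.mono_neutral_left) (auto simp: in_keys_iff)

lemma scal_sum: "scal c (sum f A) = (\<Sum>a\<in>A. scal c (f a))"
  by (induction A rule: infinite_finite_induct) (simp_all add: scal_add_right)

lemma klinear_lin [intro]: "klinear (lin \<phi>)"
proof (rule klinearI)
  fix x y :: "'a \<Rightarrow>\<^sub>0 'b"
  have "keys (x + y) \<subseteq> keys x \<union> keys y" by (rule Poly_Mapping.keys_add)
  then show "lin \<phi> (x + y) = lin \<phi> x + lin \<phi> y"
    by (simp add: lin_superset[of "keys x \<union> keys y"] lookup_add scal_add_left sum.distrib)
next
  fix c and x :: "'a \<Rightarrow>\<^sub>0 'b"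
  have "keys (scal c x) \<subseteq> keys x" by (auto simp: in_keys_iff)
  then show "lin \<phi> (scal c x) = scal c (lin \<phi> x)"
    by (simp add: lin_superset[of "keys x"] scal_sum)
qed

lemma lin_single [simp]: "lin \<phi> (single a c) = scal c (\<phi> a)"
  by (simp add: lin_superset[of "{a}"])

lemma lin_zero [simp]: "lin \<phi> 0 = 0"
  by (simp add: lin_def)

lemma lin_add: "lin \<phi> (x + y) = lin \<phi> x + lin \<phi> y"
  using klinear_lin klinear_add by blast

lemma klinear_lin_param:
  assumes "\<And>a. klinear (\<lambda>y. \<phi> y a)"
  shows "klinear (\<lambda>y. lin (\<phi> y) x)"
proof (induction x rule: poly_mapping_add_induct)
  case zero
  show ?case by (simp add: klinear_def)
next
  case (single a c)
  show ?case by (simp add: klinear_scaled assms)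
qed (simp add: lin_add klinear_plus)

text \<open>The weight is a parameter because degree is the size of a multiset in the twisted monoid
  algebra and the length of a word in the free algebra.\<close>

definition hom_wt :: "('a \<Rightarrow> nat) \<Rightarrow> nat \<Rightarrow> ('a \<Rightarrow>\<^sub>0 'r::zero) \<Rightarrow> bool"
  where "hom_wt w d x \<longleftrightarrow> (\<forall>a\<in>keys x. w a = d)"

lemma hom_wt_alt: "hom_wt w d x \<longleftrightarrow> (\<forall>a. lookup x a \<noteq> 0 \<longrightarrow> w a = d)"
  by (auto simp: hom_wt_def in_keys_iff)

lemma hom_wt_zero [simp]: "hom_wt w d 0"
  by (simp add: hom_wt_def)

lemma hom_wt_single: "w a = d \<Longrightarrow> hom_wt w d (single a c)"
  by (simp add: hom_wt_def)

lemma hom_wt_add: "hom_wt w d x \<Longrightarrow> hom_wt w d y \<Longrightarrow> hom_wt w d (x + y :: _ \<Rightarrow>\<^sub>0 'r::comm_ring_1)"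
  unfolding hom_wt_alt lookup_add by (metis add.right_neutral)

lemma hom_wt_scal: "hom_wt w d x \<Longrightarrow> hom_wt w d (scal c x)"
  unfolding hom_wt_alt lookup_scal by (metis mult_zero_right)

lemma hom_wt_minus: "hom_wt w d x \<Longrightarrow> hom_wt w d (- x :: _ \<Rightarrow>\<^sub>0 'r::comm_ring_1)"
  unfolding hom_wt_alt by auto

lemma hom_wt_diff: "hom_wt w d x \<Longrightarrow> hom_wt w d y \<Longrightarrow> hom_wt w d (x - y :: _ \<Rightarrow>\<^sub>0 'r::comm_ring_1)"
  using hom_wt_add[of w d x "- y"] hom_wt_minus by force

lemma hom_wt_sum: "(\<And>a. a \<in> A \<Longrightarrow> hom_wt w d (f a)) \<Longrightarrow> hom_wt w d (sum f A :: _ \<Rightarrow>\<^sub>0 'r::comm_ring_1)"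
  by (induction A rule: infinite_finite_induct) (auto simp: hom_wt_add)

lemma hom_wt_lin:
  assumes "hom_wt w d x" and "\<And>a. w a = d \<Longrightarrow> hom_wt v e (\<phi> a)"
  shows "hom_wt v e (lin \<phi> x)"
  using assms unfolding lin_def by (intro hom_wt_sum hom_wt_scal) (auto simp: hom_wt_def)

section \<open>The twisted monoid algebra\<close>

text \<open>The factor b in x^m x^n = b x^(m+n) for ordered monomials: every letter \<open>j\<close>
  of \<open>m\<close> has to pass every smaller letter \<open>i\<close> of \<open>n\<close>, at the
  cost of \<open>q (i, j)\<close> each time, so the exponent counts inversions.\<close>

definition bichar :: "('n::{finite,linorder} \<times> 'n \<Rightarrow> 'r) \<Rightarrow> 'n multiset \<Rightarrow> 'n multiset \<Rightarrow> 'r::comm_ring_1"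
  where "bichar q m n = (\<Prod>(i, j)\<in>index_pairs. q (i, j) ^ (count m j * count n i))"

lemma bichar_add_left: "bichar q (m + m') n = bichar q m n * bichar q m' n"
  and bichar_add_right: "bichar q m (n + n') = bichar q m n * bichar q m n'"
  by (simp_all add: bichar_def case_prod_unfold power_add algebra_simps prod.distrib)

lemma bichar_zero_left [simp]: "bichar q {#} n = 1"
  and bichar_zero_right [simp]: "bichar q m {#} = 1"
  by (simp_all add: bichar_def case_prod_unfold)

lemma bichar_singles: "bichar q {#j#} {#i#} = (if i < j then q (i, j) else 1)"
proof -
  have "bichar q {#j#} {#i#} = (\<Prod>p\<in>index_pairs. if p = (i, j) then q (i, j) else 1)"
    unfolding bichar_def
  proof (intro prod.cong refl)
    fix p
    show "(case p of (a, b) \<Rightarrow> q (a, b) ^ (count {#j#} b * count {#i#} a))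
        = (if p = (i, j) then q (i, j) else 1)"
      by (cases p; cases "fst p = i"; cases "snd p = j") auto
  qed
  also have "\<dots> = (if i < j then q (i, j) else 1)"
    by (subst prod.delta) (auto simp: index_pairs_def)
  finally show ?thesis .
qed

lemma bichar_sorted:
  assumes "\<And>j. j \<in># n \<Longrightarrow> i \<le> j"
  shows "bichar q {#i#} n = 1"
  using assms
proof (induction n)
  case (add j n)
  have "bichar q {#i#} (add_mset j n) = bichar q {#i#} {#j#} * bichar q {#i#} n"
    by (metis add_mset_add_single bichar_add_right mult.commute)
  moreover have "i \<le> j" using add.prems by simp
  ultimately show ?case using add by (simp add: bichar_singles leD)
qed simp

definition qmult :: "('n::{finite,linorder} \<times> 'n \<Rightarrow> 'r) \<Rightarrow>
    ('n multiset \<Rightarrow>\<^sub>0 'r) \<Rightarrow> ('n multiset \<Rightarrow>\<^sub>0 'r) \<Rightarrow> ('n multiset \<Rightarrow>\<^sub>0 'r::comm_ring_1)"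
  where "qmult q x y = lin (\<lambda>m. lin (\<lambda>n. single (m + n) (bichar q m n)) y) x"

lemma qmult_single: "qmult q (single m c) (single n d)
    = single (m + n) (c * d * bichar q m n)"
  by (simp add: qmult_def mult.assoc)

lemma klinear_qmult_left: "klinear (\<lambda>x. qmult q x y)"
  unfolding qmult_def by (rule klinear_lin)

lemma klinear_qmult_right: "klinear (qmult q x)"
  unfolding qmult_def by (rule klinear_lin_param) (rule klinear_lin)

lemmas qmult_add_left = klinear_add[OF klinear_qmult_left]
lemmas qmult_add_right = klinear_add[OF klinear_qmult_right]
lemmas qmult_diff_left = klinear_diff[OF klinear_qmult_left]
lemmas qmult_diff_right = klinear_diff[OF klinear_qmult_right]
lemmas qmult_minus_left = klinear_minus[OF klinear_qmult_left]
lemmas qmult_minus_right = klinear_minus[OF klinear_qmult_right]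
lemmas qmult_scal_left = klinear_scal[OF klinear_qmult_left]
lemmas qmult_scal_right = klinear_scal[OF klinear_qmult_right]
lemmas qmult_zero_left [simp] = klinear_zero[OF klinear_qmult_left]
lemmas qmult_zero_right [simp] = klinear_zero[OF klinear_qmult_right]

text \<open>On monomials with exponents m, n, k both bracketings carry the factor b(m, n) b(m, k)
  b(n, k), by bimultiplicativity.\<close>

lemma qmult_assoc: "qmult q (qmult q x y) z = qmult q x (qmult q y z)"
proof (rule klinear_ext[where x = z])
  fix k
  show "qmult q (qmult q x y) (single k 1)
      = qmult q x (qmult q y (single k 1))"
    by (rule klinear_ext2[where x = x and y = y])
      (auto simp: qmult_single bichar_add_left bichar_add_right ac_simps
        intro!: klinear_compose[OF klinear_qmult_left] klinear_compose[OF klinear_qmult_right]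
          klinear_qmult_left klinear_qmult_right)
qed (auto intro!: klinear_compose[OF klinear_qmult_right] klinear_qmult_right)

abbreviation gen :: "'n \<Rightarrow> ('n multiset \<Rightarrow>\<^sub>0 'r::comm_ring_1)"
  where "gen i \<equiv> single {#i#} 1"

lemma qmult_one_left [simp]: "qmult q 1 x = x"
  by (rule klinear_ext[OF klinear_qmult_right klinear_id])
    (simp add: qmult_single single_one[symmetric] del: single_one)

lemma qmult_one_right [simp]: "qmult q x 1 = x"
  by (rule klinear_ext[OF klinear_qmult_left klinear_id])
    (simp add: qmult_single single_one[symmetric] del: single_one)

lemma hom_wt_qmult:
  assumes "hom_wt size d x" "hom_wt size e y"
  shows "hom_wt size (d + e) (qmult q x y)"
  unfolding qmult_def
  by (rule hom_wt_lin[OF assms(1)], rule hom_wt_lin[OF assms(2)]) (simp add: hom_wt_single)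

section \<open>Normal forms in the free algebra\<close>

text \<open>The cost of sorting the word: one factor for each inversion.\<close>

fun wcoef :: "('n::{finite,linorder} \<times> 'n \<Rightarrow> 'r) \<Rightarrow> 'n list \<Rightarrow> 'r::comm_ring_1"
  where "wcoef q [] = 1"
  | "wcoef q (i # w) = bichar q {#i#} (mset w) * wcoef q w"

text \<open>Inversions of \<open>u @ v\<close> lie within \<open>u\<close>, within \<open>v\<close>,
  or between the two; the last kind is the twist of \<open>qmult\<close>, which makes
  \<open>nf\<close> multiplicative.\<close>

lemma wcoef_append: "wcoef q (u @ v) = wcoef q u * wcoef q v * bichar q (mset u) (mset v)"
proof (induction u)
  case (Cons i u)
  have "bichar q (mset (i # u)) (mset v) = bichar q {#i#} (mset v) * bichar q (mset u) (mset v)"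
    by (metis bichar_add_left mset.simps(2) add_mset_add_single mult.commute)
  then show ?case using Cons by (simp add: bichar_add_right ac_simps)
qed simp

lemma wcoef_sorted: "sorted w \<Longrightarrow> wcoef q w = 1"
  by (induction w) (auto intro!: bichar_sorted)

definition nf :: "('n::{finite,linorder} \<times> 'n \<Rightarrow> 'r) \<Rightarrow>
    ('n word \<Rightarrow>\<^sub>0 'r) \<Rightarrow> ('n multiset \<Rightarrow>\<^sub>0 'r::comm_ring_1)"
  where "nf q = lin (\<lambda>w. single (mset (letters w)) (wcoef q (letters w)))"

definition sect :: "('n::linorder multiset \<Rightarrow>\<^sub>0 'r) \<Rightarrow> ('n word \<Rightarrow>\<^sub>0 'r::comm_ring_1)"
  where "sect = lin (\<lambda>m. single (Word (sorted_list_of_multiset m)) 1)"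

lemma klinear_nf: "klinear (nf q)"
  unfolding nf_def by (rule klinear_lin)

lemma klinear_sect: "klinear sect"
  unfolding sect_def by (rule klinear_lin)

lemmas nf_add = klinear_add[OF klinear_nf] and nf_diff = klinear_diff[OF klinear_nf]
  and nf_zero [simp] = klinear_zero[OF klinear_nf]

lemma nf_single: "nf q (single w c)
    = single (mset (letters w)) (c * wcoef q (letters w))"
  by (simp add: nf_def)

lemma sect_single: "sect (single m c)
    = single (Word (sorted_list_of_multiset m)) c"
  by (simp add: sect_def)

lemma nf_sect [simp]: "nf q (sect x) = x"
  by (rule klinear_ext[OF klinear_compose[OF klinear_nf klinear_sect] klinear_id])
    (simp add: sect_single nf_single wcoef_sorted)

text \<open>The algebra is not commutative, so moving a scalar out of the right factor uses that the
  empty word is central and that coefficients commute.\<close>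

lemma scal_mult_left: "scal c p * r = scal c (p * r)"
  and scal_mult_right: "p * scal c r = scal c (p * r)"
  for p r :: "'n word \<Rightarrow>\<^sub>0 'r::comm_ring_1"
proof -
  show "scal c p * r = scal c (p * r)"
    by (simp add: scal_def mult_map_scale_conv_mult mult.assoc)
  have "p * single 0 c = single 0 c * p"
    by (rule additive_ext[where x = p and f = "\<lambda>p. p * single 0 c" and g = "\<lambda>p. single 0 c * p"])
      (simp_all add: mult_single distrib_left distrib_right mult.commute)
  then show "p * scal c r = scal c (p * r)"
    by (simp add: scal_def mult_map_scale_conv_mult mult.assoc[symmetric])
qed

lemma klinear_mult_left: "klinear (\<lambda>p. p * r)" and klinear_mult_right: "klinear (\<lambda>r. p * r)"
  for p r :: "'n word \<Rightarrow>\<^sub>0 'r::comm_ring_1"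
  by (auto intro!: klinearI simp: distrib_left distrib_right scal_mult_left scal_mult_right)

lemma nf_mult: "nf q (p * r) = qmult q (nf q p) (nf q r)"
  by (rule klinear_ext2[where x = p and y = r])
    (auto intro!: klinear_compose[OF klinear_nf] klinear_mult_left klinear_mult_right klinear_nf
      klinear_compose[OF klinear_qmult_left] klinear_compose[OF klinear_qmult_right klinear_nf]
      simp: mult_single nf_single qmult_single plus_word_def wcoef_append)

lemma nf_var: "nf q (var i) = gen i"
  by (simp add: var_def nf_single)

lemma const_mult: "const c * p = scal c p"
  by (simp add: const_def scal_def mult_map_scale_conv_mult)

lemma nf_const: "nf q (const c) = scal c 1"
  by (simp add: const_def nf_single zero_word_def single_one[symmetric] del: single_one)

lemma nf_one: "nf q 1 = 1"
  using nf_const[of q 1] by (simp add: const_def)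

lemma nf_relation:
  assumes "i < j"
  shows "nf q (var j * var i - const (q (i, j)) * var i * var j) = 0"
  using assms less_not_sym[OF assms]
  by (simp add: nf_diff nf_mult nf_var nf_const qmult_single bichar_singles add_mset_commute
      qmult_scal_left)

section \<open>The ideal generated by the relations\<close>

lemma ring_free_alg: "ring (free_alg :: ('n word \<Rightarrow>\<^sub>0 'r::comm_ring_1) ring)"
proof (rule ringI)
  show "abelian_group (free_alg :: ('n word \<Rightarrow>\<^sub>0 'r) ring)"
  proof (rule abelian_groupI)
    fix x :: "'n word \<Rightarrow>\<^sub>0 'r"
    show "\<exists>y\<in>carrier free_alg. y \<oplus>\<^bsub>free_alg\<^esub> x = \<zero>\<^bsub>free_alg\<^esub>"
      by (rule bexI[of _ "- x"]) (simp_all add: free_alg_def)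
  qed (simp_all add: free_alg_def add.assoc add.commute)
  show "Group.monoid (free_alg :: ('n word \<Rightarrow>\<^sub>0 'r) ring)"
    by (rule monoidI) (simp_all add: free_alg_def mult.assoc)
qed (simp_all add: free_alg_def distrib_left distrib_right)

lemma ideal_free_algI:
  assumes "0 \<in> I" "\<And>x y. x \<in> I \<Longrightarrow> y \<in> I \<Longrightarrow> x + y \<in> I"
    "\<And>x y. x \<in> I \<Longrightarrow> y * x \<in> I" "\<And>x y. x \<in> I \<Longrightarrow> x * y \<in> I"
  shows "ideal I free_alg"
proof (rule idealI[OF ring_free_alg])
  interpret ring free_alg by (rule ring_free_alg)
  show "subgroup I (add_monoid free_alg)"
  proof
    fix x assume x: "x \<in> I"
    have "inv\<^bsub>add_monoid free_alg\<^esub> x = - x"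
      unfolding a_inv_def[symmetric]
      by (rule minus_equality) (simp_all add: free_alg_def)
    \<comment> \<open>Negation is multiplication by -1, so closure under products suffices.\<close>
    then show "inv\<^bsub>add_monoid free_alg\<^esub> x \<in> I"
      using assms(3)[OF x, of "-1"] by simp
  qed (use assms in \<open>simp_all add: free_alg_def\<close>)
qed (use assms in \<open>simp_all add: free_alg_def\<close>)

lemma ideal_qideal: "ideal (qideal q) free_alg"
proof -
  interpret ring free_alg by (rule ring_free_alg)
  show ?thesis unfolding qideal_def by (rule genideal_ideal) (simp add: free_alg_def)
qed

lemma qideal_minimal:
  assumes "ideal I free_alg" "\<And>i j. i < j \<Longrightarrow> var j * var i - const (q (i, j)) * var i * var j \<in> I"
  shows "qideal q \<subseteq> I"
proof -
  interpret ring free_alg by (rule ring_free_alg)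
  show ?thesis unfolding qideal_def
    by (rule genideal_minimal[OF assms(1)]) (auto simp: qrelations_def assms(2))
qed

lemma qideal_relation:
  assumes "i < j"
  shows "var j * var i - const (q (i, j)) * var i * var j \<in> qideal q"
proof -
  interpret ring free_alg by (rule ring_free_alg)
  show ?thesis unfolding qideal_def
    by (rule genideal_self[THEN subsetD]) (use assms in \<open>auto simp: free_alg_def qrelations_def\<close>)
qed

lemma qideal_zero: "0 \<in> qideal q"
  and qideal_add: "x \<in> qideal q \<Longrightarrow> y \<in> qideal q \<Longrightarrow> x + y \<in> qideal q"
  and qideal_mult_left: "x \<in> qideal q \<Longrightarrow> y * x \<in> qideal q"
  and qideal_mult_right: "x \<in> qideal q \<Longrightarrow> x * y \<in> qideal q"
proof -
  interpret ideal "qideal q" free_alg by (rule ideal_qideal)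
  show "0 \<in> qideal q" using additive_subgroup.zero_closed[OF additive_subgroup_axioms] by (simp add: free_alg_def)
  show "x \<in> qideal q \<Longrightarrow> y \<in> qideal q \<Longrightarrow> x + y \<in> qideal q"
    using additive_subgroup.a_closed[OF additive_subgroup_axioms, of x y] by (simp add: free_alg_def)
  show "x \<in> qideal q \<Longrightarrow> y * x \<in> qideal q" using I_l_closed[of x y] by (simp add: free_alg_def)
  show "x \<in> qideal q \<Longrightarrow> x * y \<in> qideal q" using I_r_closed[of x y] by (simp add: free_alg_def)
qed

lemma qideal_scal: "x \<in> qideal q \<Longrightarrow> scal c x \<in> qideal q"
  using qideal_mult_left[of x q "const c"] by (simp add: const_mult)

section \<open>Straightening words modulo the relations\<close>

abbreviation wd :: "'n list \<Rightarrow> ('n word \<Rightarrow>\<^sub>0 'r::comm_ring_1)"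
  where "wd w \<equiv> single (Word w) 1"

lemma wd_Cons: "wd (i # w) = var i * wd w"
  by (simp add: var_def mult_single plus_word_def)

text \<open>The new letter passes each smaller letter by one relation and stops where insertion sort
  stops; the letters beyond are not smaller and cost nothing.\<close>

lemma insort_congruence:
  "wd (i # w) - scal (bichar q {#i#} (mset w)) (wd (insort i w)) \<in> qideal q" if "sorted w"
  using that
proof (induction w)
  case Nil
  show ?case by (simp add: qideal_zero)
next
  case (Cons a w)
  show ?case
  proof (cases "i \<le> a")
    case True
    then have "bichar q {#i#} (mset (a # w)) = 1"
      using Cons.prems by (intro bichar_sorted) auto
    then show ?thesis using True by (simp add: qideal_zero)
  next
    case False
    let ?b = "bichar q {#i#} (mset w)"
    from False have "a < i" by simp
    then have b: "bichar q {#i#} (mset (a # w)) = q (a, i) * ?b"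
      using bichar_add_right[of q "{#i#}" "{#a#}" "mset w"] by (simp add: bichar_singles)
    have 1: "(var i * var a - const (q (a, i)) * var a * var i) * wd w \<in> qideal q"
      using False by (intro qideal_mult_right qideal_relation) simp
    have 2: "scal (q (a, i)) (var a * (wd (i # w) - scal ?b (wd (insort i w)))) \<in> qideal q"
      using Cons by (intro qideal_scal qideal_mult_left) simp
    \<comment> \<open>Exchange \<open>i\<close> and \<open>a\<close> at the front, then apply the
      induction hypothesis behind \<open>a\<close>.\<close>
    have "wd (i # a # w) - scal (q (a, i) * ?b) (wd (a # insort i w))
      = (var i * var a - const (q (a, i)) * var a * var i) * wd w
        + scal (q (a, i)) (var a * (wd (i # w) - scal ?b (wd (insort i w))))"
      by (simp add: wd_Cons const_mult scal_mult_left scal_mult_right left_diff_distrib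
        right_diff_distrib scal_diff_right mult.assoc del: scal_single)
    then show ?thesis using qideal_add[OF 1 2] False b by simp
  qed
qed

lemma word_congruence: "wd w - scal (wcoef q w) (wd (sort w)) \<in> qideal q"
proof (induction w)
  case Nil
  show ?case by (simp add: qideal_zero)
next
  case (Cons i w)
  have 1: "var i * (wd w - scal (wcoef q w) (wd (sort w))) \<in> qideal q"
    using Cons by (rule qideal_mult_left)
  have 2: "scal (wcoef q w) (wd (i # sort w)
      - scal (bichar q {#i#} (mset (sort w))) (wd (insort i (sort w)))) \<in> qideal q"
    by (intro qideal_scal insort_congruence) simp
  show ?case using qideal_add[OF 1 2]
    by (simp add: wd_Cons right_diff_distrib scal_mult_right scal_diff_right mult.commute
      del: scal_single)
qed

lemma sect_nf_congruence: "p - sect (nf q p) \<in> qideal q"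
proof (induction p rule: poly_mapping_add_induct)
  case zero
  show ?case by (simp add: qideal_zero klinear_zero[OF klinear_sect])
next
  case (single w c)
  have "scal c (wd (letters w) - scal (wcoef q (letters w)) (wd (sort (letters w)))) \<in> qideal q"
    by (intro qideal_scal word_congruence)
  then show ?case
    by (simp add: nf_single sect_single sorted_list_of_multiset_mset scal_diff_right del: single_diff)
next
  case (add p r)
  then show ?case using qideal_add[OF add]
    by (simp add: nf_add klinear_add[OF klinear_sect] algebra_simps)
qed

text \<open>The two inclusions are independence and spanning of the ordered monomials. Independence:
  \<open>nf q\<close> is multiplicative and kills the relations. Spanning: every \<open>p\<close> is
  congruent to \<open>sect (nf q p)\<close>.\<close>

theorem qideal_eq_kernel: "qideal q = {p. nf q p = 0}"
proof
  show "qideal q \<subseteq> {p. nf q p = 0}"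
    by (rule qideal_minimal, rule ideal_free_algI) (simp_all add: nf_add nf_mult nf_relation)
  show "{p. nf q p = 0} \<subseteq> qideal q"
  proof
    fix p assume "p \<in> {p. nf q p = 0}"
    then show "p \<in> qideal q"
      using sect_nf_congruence[of p q] by (simp add: klinear_zero[OF klinear_sect])
  qed
qed

section \<open>The quantum polynomial algebra as a twisted monoid algebra\<close>

text \<open>The element of \<open>qpoly q\<close> with normal form \<open>x\<close>: cosets of the ideal are fibres of \<open>nf q\<close>.\<close>

definition fib :: "('n::{finite,linorder} \<times> 'n \<Rightarrow> 'r) \<Rightarrow>
    ('n multiset \<Rightarrow>\<^sub>0 'r) \<Rightarrow> ('n word \<Rightarrow>\<^sub>0 'r::comm_ring_1) set"
  where "fib q x = {p. nf q p = x}"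

lemma inj_fib: "inj (fib q)"
  by (rule injI) (metis (mono_tags) fib_def mem_Collect_eq nf_sect)

lemma fib_eq_iff [simp]: "fib q x = fib q y \<longleftrightarrow> x = y"
  using inj_fib by (auto dest: injD)

definition unfib :: "('n::{finite,linorder} \<times> 'n \<Rightarrow> 'r) \<Rightarrow>
    ('n word \<Rightarrow>\<^sub>0 'r) set \<Rightarrow> ('n multiset \<Rightarrow>\<^sub>0 'r::comm_ring_1)"
  where "unfib q = inv_into UNIV (fib q)"

lemma unfib_fib [simp]: "unfib q (fib q x) = x"
  by (simp add: unfib_def inv_f_f[OF inj_fib])

lemma fib_unfib: "X \<in> range (fib q) \<Longrightarrow> fib q (unfib q X) = X"
  by (simp add: unfib_def f_inv_into_f)

lemma qideal_coset: "qideal q +>\<^bsub>free_alg\<^esub> p = fib q (nf q p)"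
proof -
  have "r \<in> qideal q +>\<^bsub>free_alg\<^esub> p \<longleftrightarrow> nf q r = nf q p" for r
  proof
    assume "r \<in> qideal q +>\<^bsub>free_alg\<^esub> p"
    then show "nf q r = nf q p"
      by (auto simp: a_r_coset_def r_coset_def free_alg_def qideal_eq_kernel nf_add)
  next
    assume "nf q r = nf q p"
    then have "r - p \<in> qideal q" by (simp add: qideal_eq_kernel nf_diff)
    then show "r \<in> qideal q +>\<^bsub>free_alg\<^esub> p"
      unfolding a_r_coset_def r_coset_def free_alg_def by (auto intro!: bexI[of _ "r - p"])
  qed
  then show ?thesis by (auto simp: fib_def)
qed

lemma carrier_qpoly: "carrier (qpoly q) = range (fib q)"
proof -
  have "carrier (qpoly q) = range (\<lambda>p. fib q (nf q p))"
    unfolding qideal_coset[symmetric]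
    by (auto simp: qpoly_def FactRing_def A_RCOSETS_def RCOSETS_def a_r_coset_def free_alg_def)
  then show ?thesis by (metis (no_types, lifting) ext nf_sect surj_def image_image full_SetCompr_eq)
qed

lemma fib_carrier [simp]: "fib q x \<in> carrier (qpoly q)"
  by (simp add: carrier_qpoly)

lemma mult_qpoly [simp]: "fib q x \<otimes>\<^bsub>qpoly q\<^esub> fib q y = fib q (qmult q x y)"
proof -
  have "(qideal q +>\<^bsub>free_alg\<^esub> sect x) \<otimes>\<^bsub>qpoly q\<^esub> (qideal q +>\<^bsub>free_alg\<^esub> sect y)
      = qideal q +>\<^bsub>free_alg\<^esub> (sect x * sect y)"
    using ideal.rcoset_mult_add[OF ideal_qideal[of q], of "sect x" "sect y"]
    by (simp add: qpoly_def FactRing_def free_alg_def)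
  then show ?thesis by (simp add: qideal_coset nf_mult)
qed

lemma add_qpoly [simp]: "fib q x \<oplus>\<^bsub>qpoly q\<^esub> fib q y = fib q (x + y)"
proof -
  have "(qideal q +>\<^bsub>free_alg\<^esub> sect x) \<oplus>\<^bsub>qpoly q\<^esub> (qideal q +>\<^bsub>free_alg\<^esub> sect y)
      = qideal q +>\<^bsub>free_alg\<^esub> (sect x + sect y)"
    using abelian_subgroup.a_rcos_sum[OF abelian_subgroupI3[OF
        ideal.axioms(1)[OF ideal_qideal[of q]] ring.is_abelian_group[OF ring_free_alg]],
        of "sect x" "sect y"]
    by (simp add: qpoly_def FactRing_def free_alg_def)
  then show ?thesis by (simp add: qideal_coset nf_add)
qed

lemma one_qpoly: "\<one>\<^bsub>qpoly q\<^esub> = fib q 1"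
  by (simp add: qpoly_def FactRing_def qideal_coset free_alg_def nf_one
      qideal_coset[unfolded free_alg_def])

lemma zero_qpoly: "\<zero>\<^bsub>qpoly q\<^esub> = fib q 0"
  by (simp add: qpoly_def FactRing_def fib_def qideal_eq_kernel)

lemma smult_qpoly [simp]: "c \<odot>\<^bsub>qpoly q\<^esub> fib q x = fib q (scal c x)"
proof -
  have "c \<odot>\<^bsub>qpoly q\<^esub> fib q x = fib q (scal c 1) \<otimes>\<^bsub>qpoly q\<^esub> fib q x"
    by (simp add: qpoly_def qideal_coset nf_const)
  then show ?thesis by (simp add: qmult_scal_left)
qed

lemma grade_qpoly: "grade (qpoly q) d = fib q ` {x. hom_wt size d x}"
proof -
  have "hom_wt size d (nf q p)" if "homogeneous d p" for p
    using that unfolding nf_def homogeneous_def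
    by (intro hom_wt_lin[where w = "\<lambda>w. length (letters w)" and d = d])
      (auto simp: hom_wt_def)
  moreover have "homogeneous d (sect x)" if "hom_wt size d x" for x :: "'a multiset \<Rightarrow>\<^sub>0 'b"
    using hom_wt_lin[OF that, where v = "\<lambda>w. length (letters w)" and e = d
        and \<phi> = "\<lambda>m. single (Word (sorted_list_of_multiset m)) 1"]
    unfolding sect_def homogeneous_def hom_wt_def
    by (simp flip: size_mset)
  ultimately show ?thesis
    by (auto simp: qpoly_def qideal_coset) (metis (mono_tags, lifting) image_iff mem_Collect_eq nf_sect)
qed

lemma fib_in_grade [simp]: "fib q x \<in> grade (qpoly q) d \<longleftrightarrow> hom_wt size d x"
  by (auto simp: grade_qpoly)

lemma abelian_group_qpoly:
  fixes q :: "'n::{finite,linorder} \<times> 'n \<Rightarrow> 'r::comm_ring_1"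
  shows "abelian_group (qpoly q)"
proof (rule abelian_groupI)
  fix x assume "x \<in> carrier (qpoly q)"
  then obtain u where "x = fib q u" by (auto simp: carrier_qpoly)
  then show "\<exists>y\<in>carrier (qpoly q). y \<oplus>\<^bsub>qpoly q\<^esub> x = \<zero>\<^bsub>qpoly q\<^esub>"
    by (intro bexI[of _ "fib q (- u)"]) (simp_all add: zero_qpoly)
qed (auto simp: carrier_qpoly zero_qpoly ac_simps)

lemma a_inv_qpoly: "\<ominus>\<^bsub>qpoly q\<^esub> fib q x = fib q (- x)"
  by (rule abelian_group.minus_equality[OF abelian_group_qpoly]) (simp_all add: zero_qpoly)

section \<open>Hochschild cochains in coordinates\<close>

definition hom_wt_map1 ::
    "(('n multiset \<Rightarrow>\<^sub>0 'r::comm_ring_1) \<Rightarrow> ('n multiset \<Rightarrow>\<^sub>0 'r)) \<Rightarrow> bool"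
  where "hom_wt_map1 G \<longleftrightarrow> klinear G \<and> (\<forall>d x. hom_wt size d x \<longrightarrow> hom_wt size d (G x))"

definition hom_wt_map2 ::
    "(('n multiset \<Rightarrow>\<^sub>0 'r::comm_ring_1) \<Rightarrow> ('n multiset \<Rightarrow>\<^sub>0 'r) \<Rightarrow> ('n multiset \<Rightarrow>\<^sub>0 'r)) \<Rightarrow> bool"
  where "hom_wt_map2 F \<longleftrightarrow> (\<forall>x. klinear (F x)) \<and> (\<forall>y. klinear (\<lambda>x. F x y)) \<and>
    (\<forall>d e x y. hom_wt size d x \<longrightarrow> hom_wt size e y \<longrightarrow> hom_wt size (d + e) (F x y))"

definition hdiff1 :: "('n::{finite,linorder} \<times> 'n \<Rightarrow> 'r) \<Rightarrow>
    (('n multiset \<Rightarrow>\<^sub>0 'r::comm_ring_1) \<Rightarrow> ('n multiset \<Rightarrow>\<^sub>0 'r)) \<Rightarrow>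
    ('n multiset \<Rightarrow>\<^sub>0 'r) \<Rightarrow> ('n multiset \<Rightarrow>\<^sub>0 'r) \<Rightarrow> ('n multiset \<Rightarrow>\<^sub>0 'r)"
  where "hdiff1 q G x y = qmult q x (G y) - G (qmult q x y) + qmult q (G x) y"

text \<open>The Hochschild identity with its negative terms moved across: each side is the
  \<epsilon>-part of one bracketing of a triple product in the deformation by
  \<open>F\<close>.\<close>

definition cocycle2 :: "('n::{finite,linorder} \<times> 'n \<Rightarrow> 'r) \<Rightarrow>
    (('n multiset \<Rightarrow>\<^sub>0 'r::comm_ring_1) \<Rightarrow> ('n multiset \<Rightarrow>\<^sub>0 'r) \<Rightarrow> ('n multiset \<Rightarrow>\<^sub>0 'r)) \<Rightarrow> bool"
  where "cocycle2 q F \<longleftrightarrow> hom_wt_map2 F \<and> (\<forall>x y z.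
    qmult q x (F y z) + F x (qmult q y z) = F (qmult q x y) z + qmult q (F x y) z)"

definition coch1 :: "('n::{finite,linorder} \<times> 'n \<Rightarrow> 'r) \<Rightarrow>
    (('n multiset \<Rightarrow>\<^sub>0 'r::comm_ring_1) \<Rightarrow> ('n multiset \<Rightarrow>\<^sub>0 'r)) \<Rightarrow>
    ('n word \<Rightarrow>\<^sub>0 'r) set list \<Rightarrow> ('n word \<Rightarrow>\<^sub>0 'r) set"
  where "coch1 q G = (\<lambda>xs\<in>tuples (qpoly q) 1. fib q (G (unfib q (xs ! 0))))"

definition coch2 :: "('n::{finite,linorder} \<times> 'n \<Rightarrow> 'r) \<Rightarrow>
    (('n multiset \<Rightarrow>\<^sub>0 'r::comm_ring_1) \<Rightarrow> ('n multiset \<Rightarrow>\<^sub>0 'r) \<Rightarrow> ('n multiset \<Rightarrow>\<^sub>0 'r)) \<Rightarrow>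
    ('n word \<Rightarrow>\<^sub>0 'r) set list \<Rightarrow> ('n word \<Rightarrow>\<^sub>0 'r) set"
  where "coch2 q F = (\<lambda>xs\<in>tuples (qpoly q) 2.
    fib q (F (unfib q (xs ! 0)) (unfib q (xs ! 1))))"

lemma tuples_1: "tuples (qpoly q) (Suc 0) = range (\<lambda>x. [fib q x])"
  by (auto simp: tuples_def carrier_qpoly length_Suc_conv)

lemma tuples_2: "tuples (qpoly q) 2 = {[fib q x, fib q y] |x y. True}"
  by (auto simp: tuples_def carrier_qpoly length_Suc_conv numeral_2_eq_2)

lemma tuples_3: "tuples (qpoly q) 3 = {[fib q x, fib q y, fib q z] |x y z. True}"
  by (auto simp: tuples_def carrier_qpoly length_Suc_conv numeral_3_eq_3)

lemma Ball_carrier_qpoly: "(\<forall>a\<in>carrier (qpoly q). P a) \<longleftrightarrow> (\<forall>x. P (fib q x))"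
  by (auto simp: carrier_qpoly)

lemma All_less_2: "(\<forall>i<2. P i) \<longleftrightarrow> P 0 \<and> P (1::nat)"
  by (auto simp: less_2_cases_iff)

lemma coch1_apply [simp]: "coch1 q G [fib q x] = fib q (G x)"
  by (simp add: coch1_def tuples_1)

lemma coch2_apply [simp]: "coch2 q F [fib q x, fib q y] = fib q (F x y)"
  by (auto simp: coch2_def tuples_2)

lemma coch2_eq_iff: "coch2 q F = coch2 q F' \<longleftrightarrow> F = F'"
proof
  assume "coch2 q F = coch2 q F'"
  then have "coch2 q F [fib q x, fib q y] = coch2 q F' [fib q x, fib q y]" for x y by simp
  then show "F = F'" by (auto simp: fun_eq_iff)
qed simp

lemma ext_tuples_1:
  assumes "f \<in> extensional (tuples (qpoly q) 1)" "g \<in> extensional (tuples (qpoly q) 1)"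
    "\<And>x. f [fib q x] = g [fib q x]"
  shows "f = g"
  using assms by (intro extensionalityI[of f "tuples (qpoly q) 1"]) (auto simp: tuples_1)

lemma ext_tuples_2:
  assumes "f \<in> extensional (tuples (qpoly q) 2)" "g \<in> extensional (tuples (qpoly q) 2)"
    "\<And>x y. f [fib q x, fib q y] = g [fib q x, fib q y]"
  shows "f = g"
  using assms by (intro extensionalityI[of f "tuples (qpoly q) 2"]) (auto simp: tuples_2)

lemma ext_tuples_3:
  assumes "f \<in> extensional (tuples (qpoly q) 3)" "g \<in> extensional (tuples (qpoly q) 3)"
    "\<And>x y z. f [fib q x, fib q y, fib q z] = g [fib q x, fib q y, fib q z]"
  shows "f = g"
  using assms by (intro extensionalityI[of f "tuples (qpoly q) 3"]) (auto simp: tuples_3)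

lemma coch1_extensional [simp]: "coch1 q G \<in> extensional (tuples (qpoly q) 1)"
  and coch2_extensional [simp]: "coch2 q F \<in> extensional (tuples (qpoly q) 2)"
  by (simp_all add: coch1_def coch2_def)

lemma coch1_graded:
  assumes "hom_wt_map1 G"
  shows "coch1 q G \<in> graded_cochains (qpoly q) 1"
proof -
  have G: "klinear G" "\<And>d x. hom_wt size d x \<Longrightarrow> hom_wt size d (G x)"
    using assms by (auto simp: hom_wt_map1_def)
  have "coch1 q G \<in> tuples (qpoly q) 1 \<rightarrow>\<^sub>E carrier (qpoly q)"
    by (auto simp: PiE_def tuples_1 coch1_def)
  then show ?thesis
    by (auto simp: graded_cochains_def cochains_def tuples_1 carrier_qpoly klinear_add[OF G(1)]
        klinear_scal[OF G(1)] length_Suc_conv grade_qpoly G(2))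
qed

lemma graded_cochains_1: "graded_cochains (qpoly q) 1 = coch1 q ` Collect hom_wt_map1"
proof
  show "coch1 q ` Collect hom_wt_map1 \<subseteq> graded_cochains (qpoly q) 1"
    using coch1_graded by blast
  show "graded_cochains (qpoly q) 1 \<subseteq> coch1 q ` Collect hom_wt_map1"
  proof
    fix f assume f: "f \<in> graded_cochains (qpoly q) 1"
    define G where "G x = unfib q (f [fib q x])" for x
    have ext: "f \<in> tuples (qpoly q) 1 \<rightarrow>\<^sub>E carrier (qpoly q)"
      using f by (simp add: graded_cochains_def cochains_def)
    then have "f [fib q x] \<in> carrier (qpoly q)" for x
      by (rule PiE_mem) (simp add: tuples_1)
    then have fG: "f [fib q x] = fib q (G x)" for x
      unfolding G_def carrier_qpoly by (simp add: fib_unfib)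
    have t: "[fib q x] \<in> tuples (qpoly q) 1" for x by (simp add: tuples_1)
    \<comment> \<open>The only entry of the tuple is overwritten, so the tuple containing 0 serves
      for all arguments.\<close>
    have lin: "(\<forall>a\<in>carrier (qpoly q). \<forall>b\<in>carrier (qpoly q).
        f [a \<oplus>\<^bsub>qpoly q\<^esub> b] = f [a] \<oplus>\<^bsub>qpoly q\<^esub> f [b])
      \<and> (\<forall>c. \<forall>a\<in>carrier (qpoly q). f [c \<odot>\<^bsub>qpoly q\<^esub> a] = c \<odot>\<^bsub>qpoly q\<^esub> f [a])"
      using f t[of 0] unfolding graded_cochains_def cochains_def
      by (fastforce dest: bspec[where x = "[fib q 0]"])
    then have add: "f [fib q x \<oplus>\<^bsub>qpoly q\<^esub> fib q y] = f [fib q x] \<oplus>\<^bsub>qpoly q\<^esub> f [fib q y]"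
      and scal: "f [c \<odot>\<^bsub>qpoly q\<^esub> fib q x] = c \<odot>\<^bsub>qpoly q\<^esub> f [fib q x]" for c x y
      using fib_carrier by blast+
    have "klinear G"
      using add scal by (intro klinearI) (simp_all add: fG)
    moreover have "hom_wt size d (G x)" if "hom_wt size d x" for d x
    proof -
      have "f [fib q x] \<in> grade (qpoly q) (sum_list [d])"
        using f that fib_in_grade[of q x d] unfolding graded_cochains_def
        by (elim CollectE conjE allE[of _ "[d]"] allE[of _ "[fib q x]"]) simp
      then show ?thesis by (simp add: fG)
    qed
    ultimately have "hom_wt_map1 G" by (simp add: hom_wt_map1_def)
    moreover have "f = coch1 q G"
      using ext by (intro ext_tuples_1[of _ q]) (auto simp: fG PiE_def simp del: One_nat_def)
    ultimately show "f \<in> coch1 q ` Collect hom_wt_map1" by blast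
  qed
qed

lemma coch2_graded:
  assumes "hom_wt_map2 F"
  shows "coch2 q F \<in> graded_cochains (qpoly q) 2"
proof -
  have F: "klinear (F x)" "klinear (\<lambda>x. F x y)"
    "\<And>d e x y. hom_wt size d x \<Longrightarrow> hom_wt size e y \<Longrightarrow> hom_wt size (d + e) (F x y)" for x y
    using assms by (auto simp: hom_wt_map2_def)
  have "coch2 q F \<in> tuples (qpoly q) 2 \<rightarrow>\<^sub>E carrier (qpoly q)"
    by (auto simp: PiE_def tuples_2 coch2_def)
  moreover have "F (scal c x) y = scal c (F x y)" "F x (scal c y) = scal c (F x y)"
    "F (x + x') y = F x y + F x' y" "F x (y + y') = F x y + F x y'" for c x y x' y'
    using klinear_add[OF F(1)] klinear_scal[OF F(1)] klinear_add[OF F(2)] klinear_scal[OF F(2)]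
    by auto
  moreover have "(\<forall>xs\<in>tuples (qpoly q) 2. P xs) \<longleftrightarrow> (\<forall>x y. P [fib q x, fib q y])" for P
    by (auto simp: tuples_2)
  ultimately have "coch2 q F \<in> cochains (qpoly q) 2"
    by (simp add: cochains_def Ball_carrier_qpoly All_less_2)
  moreover have "coch2 q F xs \<in> grade (qpoly q) (sum_list ds)"
    if len: "length ds = 2" "length xs = 2" and gr: "\<forall>i<2. xs ! i \<in> grade (qpoly q) (ds ! i)" for ds xs
  proof -
    obtain d e where ds: "ds = [d, e]" using len(1) by (auto simp: length_Suc_conv numeral_2_eq_2)
    obtain X Y where xs: "xs = [X, Y]" using len(2) by (auto simp: length_Suc_conv numeral_2_eq_2)
    obtain x y where "X = fib q x" "Y = fib q y" "hom_wt size d x" "hom_wt size e y"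
      using gr by (auto simp: ds xs All_less_2 grade_qpoly)
    then show ?thesis by (simp add: ds xs F(3))
  qed
  ultimately show ?thesis by (simp add: graded_cochains_def)
qed

lemma graded_cochains_2: "graded_cochains (qpoly q) 2 = coch2 q ` Collect hom_wt_map2"
proof
  show "coch2 q ` Collect hom_wt_map2 \<subseteq> graded_cochains (qpoly q) 2"
    using coch2_graded by blast
  show "graded_cochains (qpoly q) 2 \<subseteq> coch2 q ` Collect hom_wt_map2"
  proof
    fix f assume f: "f \<in> graded_cochains (qpoly q) 2"
    define F where "F x y = unfib q (f [fib q x, fib q y])" for x y
    have ext: "f \<in> tuples (qpoly q) 2 \<rightarrow>\<^sub>E carrier (qpoly q)"
      using f by (simp add: graded_cochains_def cochains_def)
    then have "f [fib q x, fib q y] \<in> carrier (qpoly q)" for x y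
      by (rule PiE_mem) (auto simp: tuples_2)
    then have fF: "f [fib q x, fib q y] = fib q (F x y)" for x y
      unfolding F_def carrier_qpoly by (simp add: fib_unfib)
    have t: "[fib q x, fib q y] \<in> tuples (qpoly q) 2" for x y by (auto simp: tuples_2)
    \<comment> \<open>Entry \<open>i\<close> is overwritten, so the uses below put a dummy 0 in that
      place.\<close>
    have lin: "(\<forall>a\<in>carrier (qpoly q). \<forall>b\<in>carrier (qpoly q).
        f ([fib q x, fib q y][i := a \<oplus>\<^bsub>qpoly q\<^esub> b])
          = f ([fib q x, fib q y][i := a]) \<oplus>\<^bsub>qpoly q\<^esub> f ([fib q x, fib q y][i := b]))
      \<and> (\<forall>c. \<forall>a\<in>carrier (qpoly q). f ([fib q x, fib q y][i := c \<odot>\<^bsub>qpoly q\<^esub> a])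
          = c \<odot>\<^bsub>qpoly q\<^esub> f ([fib q x, fib q y][i := a]))" if "i < 2" for i x y
      using f t[of x y] that unfolding graded_cochains_def cochains_def by blast
    have "klinear (F x)" for x
    proof (rule klinearI)
      fix y y'
      have "f [fib q x, fib q y \<oplus>\<^bsub>qpoly q\<^esub> fib q y']
          = f [fib q x, fib q y] \<oplus>\<^bsub>qpoly q\<^esub> f [fib q x, fib q y']"
        using lin[of 1 x 0] fib_carrier
        by (metis list_update_code(2,3) One_nat_def one_less_numeral_iff semiring_norm(76))
      then show "F x (y + y') = F x y + F x y'" by (simp add: fF)
    next
      fix c y
      have "f [fib q x, c \<odot>\<^bsub>qpoly q\<^esub> fib q y] = c \<odot>\<^bsub>qpoly q\<^esub> f [fib q x, fib q y]"
        using lin[of 1 x 0] fib_carrier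
        by (metis list_update_code(2,3) One_nat_def one_less_numeral_iff semiring_norm(76))
      then show "F x (scal c y) = scal c (F x y)" by (simp add: fF)
    qed
    moreover have "klinear (\<lambda>x. F x y)" for y
    proof (rule klinearI)
      fix x x'
      have "f [fib q x \<oplus>\<^bsub>qpoly q\<^esub> fib q x', fib q y]
          = f [fib q x, fib q y] \<oplus>\<^bsub>qpoly q\<^esub> f [fib q x', fib q y]"
        using lin[of 0 0 y] fib_carrier by (metis list_update_code(2) zero_less_numeral)
      then show "F (x + x') y = F x y + F x' y" by (simp add: fF)
    next
      fix c x
      have "f [c \<odot>\<^bsub>qpoly q\<^esub> fib q x, fib q y] = c \<odot>\<^bsub>qpoly q\<^esub> f [fib q x, fib q y]"
        using lin[of 0 0 y] fib_carrier by (metis list_update_code(2) zero_less_numeral)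
      then show "F (scal c x) y = scal c (F x y)" by (simp add: fF)
    qed
    moreover have "hom_wt size (d + e) (F x y)" if "hom_wt size d x" "hom_wt size e y" for d e x y
    proof -
      have "\<forall>i<2. [fib q x, fib q y] ! i \<in> grade (qpoly q) ([d, e] ! i)"
        using that by (auto dest: less_2_cases)
      then have "f [fib q x, fib q y] \<in> grade (qpoly q) (sum_list [d, e])"
        using f unfolding graded_cochains_def by (auto simp del: sum_list.Cons)
      then show ?thesis by (simp add: fF)
    qed
    ultimately have "hom_wt_map2 F" by (simp add: hom_wt_map2_def)
    moreover have "f = coch2 q F"
      using ext by (intro ext_tuples_2[of _ q]) (auto simp: fF PiE_def)
    ultimately show "f \<in> coch2 q ` Collect hom_wt_map2" by blast
  qed
qed

section \<open>Coboundaries, cocycles and cohomology classes\<close>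

lemma hoch_diff_coch1: "hoch_diff (qpoly q) 1 (coch1 q G) = coch2 q (hdiff1 q G)"
proof (rule ext_tuples_2[of _ q])
  fix x y
  interpret abelian_group "qpoly q" by (rule abelian_group_qpoly)
  have "[fib q x, fib q y] \<in> tuples (qpoly q) (Suc 1)" by (auto simp: tuples_2 Suc_1 simp del: One_nat_def)
  then show "hoch_diff (qpoly q) 1 (coch1 q G) [fib q x, fib q y]
      = coch2 q (hdiff1 q G) [fib q x, fib q y]"
    by (simp add: hoch_diff_def lessThan_Suc hdiff1_def scal_minus_left)
qed (simp_all add: hoch_diff_def flip: numeral_2_eq_2)

lemma hoch_diff_coch2: "hoch_diff (qpoly q) 2 (coch2 q F) [fib q x, fib q y, fib q z]
  = fib q ((qmult q x (F y z) + F x (qmult q y z)) - (F (qmult q x y) z + qmult q (F x y) z))"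
proof -
  interpret abelian_group "qpoly q" by (rule abelian_group_qpoly)
  have "[fib q x, fib q y, fib q z] \<in> tuples (qpoly q) (Suc 2)"
    by (auto simp: tuples_3[simplified numeral_3_eq_3] numeral_2_eq_2)
  moreover have "{..<2::nat} = {1, 0}" by auto
  ultimately show ?thesis
    by (simp add: hoch_diff_def scal_minus_left algebra_simps)
qed

lemma graded_cocycles_2: "graded_cocycles (qpoly q) 2 = coch2 q ` Collect (cocycle2 q)"
proof -
  have "hoch_diff (qpoly q) 2 (coch2 q F) = (\<lambda>xs\<in>tuples (qpoly q) (Suc 2). \<zero>\<^bsub>qpoly q\<^esub>) \<longleftrightarrow>
      (\<forall>x y z. qmult q x (F y z) + F x (qmult q y z) = F (qmult q x y) z + qmult q (F x y) z)"
    (is "?l = ?r \<longleftrightarrow> ?c") for F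
  proof
    have t: "[fib q x, fib q y, fib q z] \<in> tuples (qpoly q) 3" for x y z by (auto simp: tuples_3)
    {
      assume *: "?l = ?r"
      show ?c
      proof (intro allI)
        fix x y z
        have "?l [fib q x, fib q y, fib q z] = ?r [fib q x, fib q y, fib q z]"
          using * by simp
        then show "qmult q x (F y z) + F x (qmult q y z) = F (qmult q x y) z + qmult q (F x y) z"
          using t[of x y z] by (simp add: hoch_diff_coch2 zero_qpoly)
      qed
    next
      assume *: ?c
      show "?l = ?r"
        by (rule ext_tuples_3[of _ q])
          (use * t in \<open>simp_all add: hoch_diff_coch2 zero_qpoly\<close>, simp_all add: hoch_diff_def)
    }
  qed
  then show ?thesis
    by (auto simp: graded_cocycles_def graded_cochains_2 cocycle2_def)
qed

lemma graded_coboundaries_2: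
  "graded_coboundaries (qpoly q) 2 = (\<lambda>G. coch2 q (hdiff1 q G)) ` Collect hom_wt_map1"
proof -
  have "graded_coboundaries (qpoly q) 2 = hoch_diff (qpoly q) 1 ` graded_cochains (qpoly q) 1"
    by (simp add: graded_coboundaries_def numeral_2_eq_2)
  then show ?thesis by (simp only: graded_cochains_1 image_image hoch_diff_coch1)
qed

text \<open>The coset of \<open>coch2 q F\<close> modulo coboundaries; the coboundary stands on the
  left to match the right cosets of the quotient group.\<close>

definition coh_class :: "('n::{finite,linorder} \<times> 'n \<Rightarrow> 'r) \<Rightarrow>
    (('n multiset \<Rightarrow>\<^sub>0 'r::comm_ring_1) \<Rightarrow> ('n multiset \<Rightarrow>\<^sub>0 'r) \<Rightarrow> ('n multiset \<Rightarrow>\<^sub>0 'r)) \<Rightarrow>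
    (('n word \<Rightarrow>\<^sub>0 'r) set list \<Rightarrow> ('n word \<Rightarrow>\<^sub>0 'r) set) set"
  where "coh_class q F = {coch2 q (\<lambda>x y. hdiff1 q G x y + F x y) |G. hom_wt_map1 G}"

lemma carrier_HH_graded: "carrier (HH_graded (qpoly q) 2) = coh_class q ` Collect (cocycle2 q)"
proof -
  have "(\<lambda>xs\<in>tuples (qpoly q) 2. coch2 q F' xs \<oplus>\<^bsub>qpoly q\<^esub> coch2 q F xs)
      = coch2 q (\<lambda>x y. F' x y + F x y)" for F F'
    by (rule ext_tuples_2[of _ q]) (simp_all, auto simp: tuples_2)
  then have "graded_coboundaries (qpoly q) 2 #>\<^bsub>cocycle_group (qpoly q) 2\<^esub> coch2 q F = coh_class q F"
    for F
    by (auto simp: r_coset_def cocycle_group_def graded_coboundaries_2 coh_class_def)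
  then show ?thesis
    by (auto simp: HH_graded_def FactGroup_def RCOSETS_def cocycle_group_def graded_cocycles_2)
qed

section \<open>Dual numbers and the Kodaira--Spencer classes\<close>

lemma dual_parts [simp]:
  "std_part 0 = 0" "eps_part 0 = 0" "std_part 1 = 1" "eps_part 1 = 0"
  "std_part (x + y) = std_part x + std_part y" "eps_part (x + y) = eps_part x + eps_part y"
  "std_part (x * y) = std_part x * std_part y"
  "eps_part (x * y) = std_part x * eps_part y + eps_part x * std_part y"
  by (simp_all add: zero_dual_def one_dual_def plus_dual_def times_dual_def)

lemma std_part_power: "std_part (x ^ n) = std_part x ^ n"
  by (induction n) simp_all

lemma std_part_prod: "std_part (prod f A) = (\<Prod>a\<in>A. std_part (f a))"
  by (induction A rule: infinite_finite_induct) simp_all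

abbreviation stdp :: "('a \<Rightarrow>\<^sub>0 'r::comm_ring_1 dual) \<Rightarrow> ('a \<Rightarrow>\<^sub>0 'r)"
  where "stdp \<equiv> Poly_Mapping.map std_part"

abbreviation epsp :: "('a \<Rightarrow>\<^sub>0 'r::comm_ring_1 dual) \<Rightarrow> ('a \<Rightarrow>\<^sub>0 'r)"
  where "epsp \<equiv> Poly_Mapping.map eps_part"

definition mkd :: "('a \<Rightarrow>\<^sub>0 'r) \<Rightarrow> ('a \<Rightarrow>\<^sub>0 'r) \<Rightarrow> ('a \<Rightarrow>\<^sub>0 'r::comm_ring_1 dual)"
  where "mkd x y = Poly_Mapping.map (\<lambda>a. Dual a 0) x + Poly_Mapping.map (Dual 0) y"

lemma lookup_stdp [simp]: "lookup (stdp x) k = std_part (lookup x k)"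
  and lookup_epsp [simp]: "lookup (epsp x) k = eps_part (lookup x k)"
  by (simp_all add: lookup_map0)

lemma lookup_mkd [simp]: "lookup (mkd x y) k = Dual (lookup x k) (lookup y k)"
  unfolding mkd_def lookup_add by (subst (1 2) lookup_map0) (simp_all add: zero_dual_def plus_dual_def)

lemma stdp_mkd [simp]: "stdp (mkd x y) = x"
  and epsp_mkd [simp]: "epsp (mkd x y) = y"
  and mkd_stdp_epsp [simp]: "mkd (stdp z) (epsp z) = z"
  and stdp_zero [simp]: "stdp 0 = 0"
  and epsp_zero [simp]: "epsp 0 = 0"
  and stdp_single [simp]: "stdp (single a d) = single a (std_part d)"
  and stdp_add: "stdp (z + w) = stdp z + stdp w"
  and epsp_add: "epsp (z + w) = epsp z + epsp w"
  and mkd_add: "mkd x y + mkd x' y' = mkd (x + x') (y + y')"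
  and stdp_scal: "stdp (scal d z) = scal (std_part d) (stdp z)"
  and epsp_scal: "epsp (scal d z) = scal (std_part d) (epsp z) + scal (eps_part d) (stdp z)"
  and scal_mkd: "scal (Dual c e) (mkd x y) = mkd (scal c x) (scal c y + scal e x)"
  by (rule poly_mapping_eqI;
      simp add: lookup_add lookup_single when_def times_dual_def plus_dual_def zero_dual_def)+

lemma mkd_eq_iff [simp]: "mkd x y = mkd x' y' \<longleftrightarrow> x = x' \<and> y = y'"
  by (metis stdp_mkd epsp_mkd)

lemma mkd_one: "mkd 1 0 = 1"
  by (rule poly_mapping_eqI) (simp add: lookup_one when_def one_dual_def zero_dual_def)

lemma mkd_eqI: "stdp z = x \<Longrightarrow> epsp z = y \<Longrightarrow> z = mkd x y"
  by (metis mkd_stdp_epsp)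

lemma hom_wt_mkd: "hom_wt w d (mkd x y) \<longleftrightarrow> hom_wt w d x \<and> hom_wt w d y"
  by (auto simp: hom_wt_alt zero_dual_def)

lemma hom_wt_stdp_epsp: "hom_wt w d z \<Longrightarrow> hom_wt w d (stdp z) \<and> hom_wt w d (epsp z)"
  using hom_wt_mkd[of w d "stdp z" "epsp z"] by simp

abbreviation dpar :: "('n \<times> 'n \<Rightarrow> 'r) \<Rightarrow> ('n \<times> 'n \<Rightarrow> 'r) \<Rightarrow> 'n \<times> 'n \<Rightarrow> 'r dual"
  where "dpar q \<alpha> \<equiv> (\<lambda>ij. Dual (q ij) (\<alpha> ij))"

lemma std_part_bichar: "std_part (bichar (dpar q \<alpha>) m n) = bichar q m n"
  by (simp add: bichar_def std_part_prod std_part_power case_prod_unfold)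

lemma stdp_qmult: "stdp (qmult (dpar q \<alpha>) z w) = qmult q (stdp z) (stdp w)"
proof (rule additive_ext[where x = w and f = "\<lambda>w. stdp (qmult (dpar q \<alpha>) z w)"
      and g = "\<lambda>w. qmult q (stdp z) (stdp w)"])
  fix b d
  show "stdp (qmult (dpar q \<alpha>) z (single b d)) = qmult q (stdp z) (stdp (single b d))"
    by (rule additive_ext[where x = z and f = "\<lambda>z. stdp (qmult (dpar q \<alpha>) z (single b d))"
          and g = "\<lambda>z. qmult q (stdp z) (stdp (single b d))"])
      (simp_all add: qmult_add_left stdp_add qmult_single std_part_bichar)
qed (simp_all add: qmult_add_right stdp_add)

lemma std_part_wcoef: "std_part (wcoef (dpar q \<alpha>) w) = wcoef q w"
  by (induction w) (simp_all add: std_part_bichar)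

lemma stdp_nf: "stdp (nf (dpar q \<alpha>) p) = nf q (stdp p)"
  by (rule additive_ext[where x = p and f = "\<lambda>p. stdp (nf (dpar q \<alpha>) p)"
        and g = "\<lambda>p. nf q (stdp p)"])
    (simp_all add: nf_add stdp_add nf_single std_part_wcoef)

lemma stdp_sect: "stdp (sect x) = sect (stdp x)"
  by (rule additive_ext[where x = x and f = "\<lambda>x. stdp (sect x)" and g = "\<lambda>x. sect (stdp x)"])
    (simp_all add: klinear_add[OF klinear_sect] stdp_add sect_single)

lemma reduce_eps_fib: "reduce_eps (fib (dpar q \<alpha>) z) = fib q (stdp z)"
proof
  show "reduce_eps (fib (dpar q \<alpha>) z) \<subseteq> fib q (stdp z)"
    by (auto simp: reduce_eps_def fib_def stdp_nf[symmetric])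
  show "fib q (stdp z) \<subseteq> reduce_eps (fib (dpar q \<alpha>) z)"
  proof
    fix p assume "p \<in> fib q (stdp z)"
    then have p: "nf q p = stdp z" by (simp add: fib_def)
    \<comment> \<open>The error \<open>u\<close> of the naive lift \<open>mkd p 0\<close> is a
      multiple of \<epsilon>, so adding \<open>sect u\<close> corrects the lift without changing its
      reduction.\<close>
    define u where "u = z - nf (dpar q \<alpha>) (mkd p 0)"
    have "u + nf (dpar q \<alpha>) (mkd p 0) = z" by (simp add: u_def)
    then have "stdp (u + nf (dpar q \<alpha>) (mkd p 0)) = stdp z" by (rule arg_cong)
    then have "stdp u + nf q p = stdp z" by (simp only: stdp_add stdp_nf stdp_mkd)
    then have "stdp u = 0" by (simp add: p)
    then have "stdp (mkd p 0 + sect u) = p"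
      by (simp add: stdp_add stdp_sect klinear_zero[OF klinear_sect])
    moreover have "mkd p 0 + sect u \<in> fib (dpar q \<alpha>) z"
      by (simp add: fib_def nf_add u_def)
    ultimately show "p \<in> reduce_eps (fib (dpar q \<alpha>) z)"
      unfolding reduce_eps_def by (intro image_eqI[where x = "mkd p 0 + sect u"]) simp_all
  qed
qed

text \<open>The derivative of the bicharacter, packaged as an \<epsilon>-part: the cocycle identity
  then comes from \<open>qmult_assoc\<close> over K[\<epsilon>], with no product rule to work
  out.\<close>

definition kscoc :: "('n::{finite,linorder} \<times> 'n \<Rightarrow> 'r) \<Rightarrow> ('n \<times> 'n \<Rightarrow> 'r) \<Rightarrow>
    ('n multiset \<Rightarrow>\<^sub>0 'r::comm_ring_1) \<Rightarrow> ('n multiset \<Rightarrow>\<^sub>0 'r) \<Rightarrow> ('n multiset \<Rightarrow>\<^sub>0 'r)"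
  where "kscoc q \<alpha> x y = epsp (qmult (dpar q \<alpha>) (mkd x 0) (mkd y 0))"

text \<open>The product with the deformed parameters coincides with the product of the
  \<open>deformation\<close> by \<open>kscoc\<close>, which is why this cocycle represents the
  Kodaira-Spencer class.\<close>

lemma qmult_mkd: "qmult (dpar q \<alpha>) (mkd x y) (mkd x' y')
    = mkd (qmult q x x') (qmult q x y' + qmult q y x' + kscoc q \<alpha> x x')"
proof -
  let ?e = "Dual 0 1"
  have split: "mkd x y = mkd x 0 + scal ?e (mkd y 0)" for x y :: "'a multiset \<Rightarrow>\<^sub>0 'b"
    by (simp add: scal_mkd mkd_add)
  have "qmult (dpar q \<alpha>) (mkd x y) (mkd x' y')
      = qmult (dpar q \<alpha>) (mkd x 0) (mkd x' 0) + scal ?e (qmult (dpar q \<alpha>) (mkd x 0) (mkd y' 0))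
        + scal ?e (qmult (dpar q \<alpha>) (mkd y 0) (mkd x' 0))
        + scal (?e * ?e) (qmult (dpar q \<alpha>) (mkd y 0) (mkd y' 0))"
    unfolding split[of x y] split[of x' y']
    by (simp add: qmult_add_left qmult_add_right qmult_scal_left qmult_scal_right scal_add_right
      algebra_simps)
  \<comment> \<open>The last summand vanishes because \<epsilon> squares to 0.\<close>
  also have "\<dots> = mkd (qmult q x x') (qmult q x y' + qmult q y x' + kscoc q \<alpha> x x')"
    by (rule mkd_eqI)
      (simp_all add: stdp_add epsp_add stdp_scal epsp_scal stdp_qmult kscoc_def)
  finally show ?thesis .
qed

lemma cocycle2_kscoc: "cocycle2 q (kscoc q \<alpha>)"
proof -
  have add: "mkd (x + y) 0 = mkd x 0 + mkd y 0" for x y :: "'a multiset \<Rightarrow>\<^sub>0 'b"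
    by (simp add: mkd_add)
  have scal: "mkd (scal c x) 0 = scal (Dual c 0) (mkd x 0)" for c and x :: "'a multiset \<Rightarrow>\<^sub>0 'b"
    by (simp add: scal_mkd)
  have "hom_wt size (d + e) (kscoc q \<alpha> x y)" if "hom_wt size d x" "hom_wt size e y" for d e x y
    unfolding kscoc_def using that
    by (intro hom_wt_stdp_epsp[THEN conjunct2] hom_wt_qmult) (simp_all add: hom_wt_mkd)
  moreover have "klinear (kscoc q \<alpha> x)" "klinear (\<lambda>x. kscoc q \<alpha> x y)" for x y
    by (auto intro!: klinearI simp: kscoc_def add scal qmult_add_left qmult_add_right
        qmult_scal_left qmult_scal_right epsp_add epsp_scal)
  moreover have "qmult q x (kscoc q \<alpha> y z) + kscoc q \<alpha> x (qmult q y z)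
      = kscoc q \<alpha> (qmult q x y) z + qmult q (kscoc q \<alpha> x y) z" for x y z
    using qmult_assoc[of "dpar q \<alpha>" "mkd x 0" "mkd y 0" "mkd z 0"]
    by (simp add: qmult_mkd add.commute)
  ultimately show ?thesis by (simp add: cocycle2_def hom_wt_map2_def)
qed

text \<open>Consequently the obstruction of \<open>kscoc q \<alpha>\<close> at i < j is
  \<open>\<alpha> (i, j)\<close> times x_i x_j, the part of a cocycle that no coboundary can
  absorb.\<close>

lemma kscoc_gens:
  assumes "i < j"
  shows "kscoc q \<alpha> (gen j) (gen i) = single {#i, j#} (\<alpha> (i, j))"
    and "kscoc q \<alpha> (gen i) (gen j) = 0"
proof -
  have "mkd (single m 1) 0 = (single m 1 :: 'a multiset \<Rightarrow>\<^sub>0 'b dual)" for m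
    by (rule poly_mapping_eqI) (auto simp: lookup_single when_def one_dual_def zero_dual_def)
  moreover have "epsp (single m d) = single m (eps_part d)" for m and d :: "'b dual"
    by (rule poly_mapping_eqI) (auto simp: lookup_single when_def)
  ultimately show "kscoc q \<alpha> (gen j) (gen i) = single {#i, j#} (\<alpha> (i, j))"
    and "kscoc q \<alpha> (gen i) (gen j) = 0"
    using assms less_not_sym[OF assms]
    by (simp_all add: kscoc_def qmult_single bichar_singles add_mset_commute)
qed

lemma cocycle2_hdiff1:
  assumes "hom_wt_map1 G"
  shows "cocycle2 q (hdiff1 q G)"
proof -
  have G: "klinear G" "\<And>d x. hom_wt size d x \<Longrightarrow> hom_wt size d (G x)"
    using assms by (auto simp: hom_wt_map1_def)
  have "hom_wt size (d + e) (hdiff1 q G x y)" if "hom_wt size d x" "hom_wt size e y" for d e x y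
    unfolding hdiff1_def using that by (intro hom_wt_add hom_wt_diff hom_wt_qmult G)
  moreover have "klinear (hdiff1 q G x)" "klinear (\<lambda>x. hdiff1 q G x y)" for x y
    unfolding hdiff1_def[abs_def]
    by (auto intro!: klinear_plus klinear_subtract klinear_compose[OF klinear_qmult_right G(1)]
        klinear_compose[OF klinear_qmult_left G(1)] klinear_compose[OF G(1) klinear_qmult_left]
        klinear_compose[OF G(1) klinear_qmult_right] klinear_qmult_left klinear_qmult_right)
  moreover have "qmult q x (hdiff1 q G y z) + hdiff1 q G x (qmult q y z)
      = hdiff1 q G (qmult q x y) z + qmult q (hdiff1 q G x y) z" for x y z
    by (simp add: hdiff1_def qmult_add_left qmult_add_right qmult_diff_left qmult_diff_right
        qmult_assoc)
  ultimately show ?thesis by (simp add: cocycle2_def hom_wt_map2_def)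
qed

lemma cocycle2_add:
  assumes "cocycle2 q F" "cocycle2 q F'"
  shows "cocycle2 q (\<lambda>x y. F x y + F' x y)"
proof -
  have "qmult q x (F y z + F' y z) + (F x (qmult q y z) + F' x (qmult q y z))
      = (qmult q x (F y z) + F x (qmult q y z)) + (qmult q x (F' y z) + F' x (qmult q y z))"
    "F (qmult q x y) z + F' (qmult q x y) z + qmult q (F x y + F' x y) z
      = (F (qmult q x y) z + qmult q (F x y) z) + (F' (qmult q x y) z + qmult q (F' x y) z)"
    for x y z
    by (simp_all add: qmult_add_left qmult_add_right)
  then show ?thesis using assms unfolding cocycle2_def hom_wt_map2_def
    by (simp add: klinear_plus hom_wt_add)
qed

lemma cocycle2_diff:
  assumes "cocycle2 q F" "cocycle2 q F'"
  shows "cocycle2 q (\<lambda>x y. F x y - F' x y)"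
proof -
  have "qmult q x (F y z - F' y z) + (F x (qmult q y z) - F' x (qmult q y z))
      = (qmult q x (F y z) + F x (qmult q y z)) - (qmult q x (F' y z) + F' x (qmult q y z))"
    "F (qmult q x y) z - F' (qmult q x y) z + qmult q (F x y - F' x y) z
      = (F (qmult q x y) z + qmult q (F x y) z) - (F' (qmult q x y) z + qmult q (F' x y) z)"
    for x y z
    by (simp_all add: qmult_diff_left qmult_diff_right)
  then show ?thesis using assms unfolding cocycle2_def hom_wt_map2_def
    by (simp add: klinear_subtract hom_wt_diff)
qed

lemma grade_deformation: "grade (deformation A f) d = grade A d \<times> grade A d"
  by (simp add: deformation_def)

lemma carrier_deformation: "carrier (deformation A f) = carrier A \<times> carrier A"
  by (simp add: deformation_def)

lemma deformation_coch2:
  "(fib q x, fib q x') \<otimes>\<^bsub>deformation (qpoly q) (coch2 q F)\<^esub> (fib q y, fib q y')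
    = (fib q (qmult q x y), fib q (qmult q x y' + qmult q x' y + F x y))"
  "(fib q x, fib q x') \<oplus>\<^bsub>deformation (qpoly q) (coch2 q F)\<^esub> (fib q y, fib q y')
    = (fib q (x + y), fib q (x' + y'))"
  "\<one>\<^bsub>deformation (qpoly q) (coch2 q F)\<^esub> = (fib q 1, fib q (- F 1 1))"
  "c \<odot>\<^bsub>deformation (qpoly q) (coch2 q F)\<^esub> (fib q x, fib q x')
    = (fib q (scal (std_part c) x), fib q (scal (std_part c) x' + scal (eps_part c) x))"
  by (simp_all add: deformation_def one_qpoly a_inv_qpoly)

text \<open>A K[\<epsilon>]-linear map that is the identity modulo \<epsilon> sends x + y \<epsilon>
  to x + (G x + y) \<epsilon>. It respects degrees when G does, and is multiplicative on the
  deformation by F exactly when F is the coboundary of G plus \<open>kscoc q \<alpha>\<close>. The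
  isomorphisms in the definition therefore run through one coset.\<close>

lemma kodaira_spencer_eq_coh_class:
  fixes q :: "'n::{finite,linorder} \<times> 'n \<Rightarrow> 'k::field"
  shows "kodaira_spencer q \<alpha> = coh_class q (kscoc q \<alpha>)"
proof
  show "kodaira_spencer q \<alpha> \<subseteq> coh_class q (kscoc q \<alpha>)"
  proof
    fix f assume f: "f \<in> kodaira_spencer q \<alpha>"
    then obtain F where F: "f = coch2 q F" "cocycle2 q F"
      by (auto simp: kodaira_spencer_def graded_cocycles_2)
    let ?D = "deformation (qpoly q) (coch2 q F)" and ?E = "qpoly (dpar q \<alpha>)"
    obtain \<phi> where iso: "\<phi> \<in> graded_alg_iso ?D ?E"
      and red: "\<And>x y. reduce_eps (\<phi> (fib q x, fib q y)) = fib q x"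
      using f by (auto simp: kodaira_spencer_def F(1) qpoly_eps_def Ball_carrier_qpoly)
    have hom: "\<phi> \<in> ring_hom ?D ?E" and grd: "\<phi> ` grade ?D d = grade ?E d"
      and smul: "u \<in> carrier ?D \<Longrightarrow> \<phi> (c \<odot>\<^bsub>?D\<^esub> u) = c \<odot>\<^bsub>?E\<^esub> \<phi> u" for c u d
      using iso by (auto simp: graded_alg_iso_def ring_iso_def)
    have D: "(fib q x, fib q y) \<in> carrier ?D" for x y by (simp add: carrier_deformation)
    define h where "h x y = unfib (dpar q \<alpha>) (\<phi> (fib q x, fib q y))" for x y
    have \<phi>: "\<phi> (fib q x, fib q y) = fib (dpar q \<alpha>) (h x y)" for x y
      using ring_hom_closed[OF hom D] by (simp add: h_def fib_unfib carrier_qpoly)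
    have std: "stdp (h x y) = x" for x y
      using red[of x y] by (simp add: \<phi> reduce_eps_fib)
    define G where "G x = epsp (h x 0)" for x
    have h0: "h x 0 = mkd x (G x)" for x
      by (rule mkd_eqI) (simp_all add: std G_def)
    have hscal: "h (scal (std_part c) x) (scal (std_part c) y + scal (eps_part c) x) = scal c (h x y)"
      for c x y
      using smul[OF D, of c x y] by (simp add: deformation_coch2 \<phi>)
    have hadd: "h (x + x') (y + y') = h x y + h x' y'" for x x' y y'
      using ring_hom_add[OF hom D D, of x y x' y'] by (simp add: deformation_coch2 \<phi>)
    \<comment> \<open>The element (0, y) is \<epsilon> times (y, 0), and \<epsilon> kills the
      unknown part \<open>G y\<close>.\<close>
    have "h 0 y = mkd 0 y" for y
      using hscal[of "Dual 0 1" y 0] by (simp add: h0 scal_mkd)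
    then have h: "h x y = mkd x (G x + y)" for x y
      using hadd[of x 0 0 y] by (simp add: h0 mkd_add)
    have "hom_wt_map1 G"
      unfolding hom_wt_map1_def
    proof (intro conjI klinearI allI impI)
      fix x y show "G (x + y) = G x + G y" using hadd[of x y 0 0] by (simp add: h mkd_add)
    next
      fix c x show "G (scal c x) = scal c (G x)"
        using hscal[of "Dual c 0" x 0] by (simp add: h scal_mkd)
    next
      fix d and x :: "'n multiset \<Rightarrow>\<^sub>0 'k" assume "hom_wt size d x"
      then have "(fib q x, fib q 0) \<in> grade ?D d" by (simp add: grade_deformation)
      then have "\<phi> (fib q x, fib q 0) \<in> grade ?E d" using grd by blast
      then show "hom_wt size d (G x)" by (simp add: \<phi> h hom_wt_mkd)
    qed
    moreover have "F = (\<lambda>x y. hdiff1 q G x y + kscoc q \<alpha> x y)"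
    proof (intro ext)
      fix x y
      have "h (qmult q x y) (F x y) = qmult (dpar q \<alpha>) (h x 0) (h y 0)"
        using ring_hom_mult[OF hom D D, of x 0 y 0] by (simp add: deformation_coch2 \<phi>)
      then have "G (qmult q x y) + F x y = qmult q x (G y) + qmult q (G x) y + kscoc q \<alpha> x y"
        by (simp add: h qmult_mkd)
      then show "F x y = hdiff1 q G x y + kscoc q \<alpha> x y"
        by (simp add: hdiff1_def algebra_simps)
    qed
    ultimately show "f \<in> coh_class q (kscoc q \<alpha>)"
      unfolding F(1) coh_class_def by blast
  qed
next
  show "coh_class q (kscoc q \<alpha>) \<subseteq> kodaira_spencer q \<alpha>"
  proof
    fix f assume "f \<in> coh_class q (kscoc q \<alpha>)"
    then obtain G where G: "hom_wt_map1 G"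
      and f: "f = coch2 q (\<lambda>x y. hdiff1 q G x y + kscoc q \<alpha> x y)"
      by (auto simp: coh_class_def)
    define F where "F x y = hdiff1 q G x y + kscoc q \<alpha> x y" for x y
    have fF: "f = coch2 q F" by (simp add: f F_def[abs_def])
    let ?D = "deformation (qpoly q) (coch2 q F)" and ?E = "qpoly (dpar q \<alpha>)"
    have lin: "klinear G" and gr: "\<And>d x. hom_wt size d x \<Longrightarrow> hom_wt size d (G x)"
      using G by (auto simp: hom_wt_map1_def)
    have "cocycle2 q F"
      unfolding F_def[abs_def] by (intro cocycle2_add cocycle2_hdiff1 cocycle2_kscoc G)
    define \<phi> where "\<phi> XY = fib (dpar q \<alpha>)
      (mkd (unfib q (fst XY)) (G (unfib q (fst XY)) + unfib q (snd XY)))" for XY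
    have \<phi>: "\<phi> (fib q x, fib q y) = fib (dpar q \<alpha>) (mkd x (G x + y))" for x y
      by (simp add: \<phi>_def)
    have carr: "carrier ?D = range (\<lambda>(x, y). (fib q x, fib q y))"
      by (auto simp: carrier_deformation carrier_qpoly)
    have "\<phi> \<in> ring_hom ?D ?E"
    proof (rule ring_hom_memI)
      \<comment> \<open>With this, \<open>F 1 1 = hdiff1 q G 1 1 = G 1\<close>, so the unit of
        \<open>?D\<close> is 1 - (G 1) \<epsilon>, and the shift by \<open>G\<close> in
        \<open>\<phi>\<close> takes it to 1.\<close>
      have "kscoc q \<alpha> 1 1 = 0"
        using epsp_mkd[of 1 0] by (simp add: kscoc_def mkd_one)
      then show "\<phi> \<one>\<^bsub>?D\<^esub> = \<one>\<^bsub>?E\<^esub>"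
        by (simp add: deformation_coch2 one_qpoly \<phi> F_def hdiff1_def mkd_one)
    next
      fix u v assume "u \<in> carrier ?D" "v \<in> carrier ?D"
      then obtain x x' y y' where "u = (fib q x, fib q x')" "v = (fib q y, fib q y')"
        unfolding carr by auto
      then show "\<phi> (u \<otimes>\<^bsub>?D\<^esub> v) = \<phi> u \<otimes>\<^bsub>?E\<^esub> \<phi> v" "\<phi> (u \<oplus>\<^bsub>?D\<^esub> v) = \<phi> u \<oplus>\<^bsub>?E\<^esub> \<phi> v"
        by (simp_all add: deformation_coch2 \<phi> qmult_mkd F_def hdiff1_def klinear_add[OF lin]
            mkd_add qmult_add_left qmult_add_right algebra_simps)
    qed (auto simp: carr \<phi>)
    moreover have "bij_betw \<phi> (carrier ?D) (carrier ?E)"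
      unfolding bij_betw_def
    proof
      show "inj_on \<phi> (carrier ?D)"
        by (rule inj_onI) (auto simp: carr \<phi>)
      have "range (fib (dpar q \<alpha>)) \<subseteq> \<phi> ` carrier ?D"
      proof (rule image_subsetI)
        fix z
        \<comment> \<open>The preimage undoes the shift by \<open>G\<close> in the
          \<epsilon>-part.\<close>
        have "fib (dpar q \<alpha>) z = \<phi> (fib q (stdp z), fib q (epsp z - G (stdp z)))"
          by (simp add: \<phi>)
        then show "fib (dpar q \<alpha>) z \<in> \<phi> ` carrier ?D"
          by (rule image_eqI) (simp add: carrier_deformation)
      qed
      moreover have "\<phi> ` carrier ?D \<subseteq> range (fib (dpar q \<alpha>))"
        by (auto simp: carr \<phi>)
      ultimately show "\<phi> ` carrier ?D = carrier ?E"
        by (auto simp: carrier_qpoly)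
    qed
    moreover have "\<phi> (c \<odot>\<^bsub>?D\<^esub> u) = c \<odot>\<^bsub>?E\<^esub> \<phi> u" if "u \<in> carrier ?D" for c u
      using that by (cases c) (auto simp: carr \<phi> deformation_coch2 scal_mkd klinear_scal[OF lin]
          scal_add_right add_ac)
    moreover have "\<phi> ` grade ?D d = grade ?E d" for d
    proof
      show "\<phi> ` grade ?D d \<subseteq> grade ?E d"
        by (auto simp: grade_deformation grade_qpoly[of q] \<phi> hom_wt_mkd gr hom_wt_add)
      show "grade ?E d \<subseteq> \<phi> ` grade ?D d"
      proof
        fix Z assume "Z \<in> grade ?E d"
        then obtain z where z: "Z = fib (dpar q \<alpha>) z" "hom_wt size d z" by (auto simp: grade_qpoly)
        have "Z = \<phi> (fib q (stdp z), fib q (epsp z - G (stdp z)))" by (simp add: \<phi> z(1))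
        moreover have "(fib q (stdp z), fib q (epsp z - G (stdp z))) \<in> grade ?D d"
          using hom_wt_stdp_epsp[OF z(2)] by (simp add: grade_deformation gr hom_wt_diff)
        ultimately show "Z \<in> \<phi> ` grade ?D d" by blast
      qed
    qed
    ultimately have "\<phi> \<in> graded_alg_iso ?D ?E"
      by (simp add: graded_alg_iso_def ring_iso_def)
    then show "f \<in> kodaira_spencer q \<alpha>"
      using \<open>cocycle2 q F\<close> unfolding kodaira_spencer_def fF graded_cocycles_2 qpoly_eps_def
      by (auto intro!: bexI[of _ \<phi>] simp: Ball_carrier_qpoly \<phi> reduce_eps_fib)
  qed
qed

section \<open>Cocycles that preserve the relations are coboundaries\<close>

text \<open>The \<open>\<epsilon>\<close>-part of the product of the elements \<open>x\<^sub>i + y\<^sub>i \<epsilon>\<close> along a word in the deformation by \<open>F\<close>,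
  whose unit is \<open>1 - F 1 1 \<epsilon>\<close>.\<close>

primrec lift_word :: "('n::{finite,linorder} \<times> 'n \<Rightarrow> 'r) \<Rightarrow>
    (('n multiset \<Rightarrow>\<^sub>0 'r::comm_ring_1) \<Rightarrow> ('n multiset \<Rightarrow>\<^sub>0 'r) \<Rightarrow> ('n multiset \<Rightarrow>\<^sub>0 'r)) \<Rightarrow>
    ('n \<Rightarrow> ('n multiset \<Rightarrow>\<^sub>0 'r)) \<Rightarrow> 'n list \<Rightarrow> ('n multiset \<Rightarrow>\<^sub>0 'r)"
  where "lift_word q F y [] = - F 1 1"
  | "lift_word q F y (i # w) = qmult q (gen i) (lift_word q F y w)
      + qmult q (y i) (nf q (wd w)) + F (gen i) (nf q (wd w))"

lemma cocycle2D:
  assumes "cocycle2 q F"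
  shows "klinear (F x)" "klinear (\<lambda>x. F x y)"
    and "hom_wt size d x \<Longrightarrow> hom_wt size e y \<Longrightarrow> hom_wt size (d + e) (F x y)"
    and "qmult q x (F y z) + F x (qmult q y z) = F (qmult q x y) z + qmult q (F x y) z"
  using assms by (auto simp: cocycle2_def hom_wt_map2_def)

text \<open>The cocycle identity at (1, 1, z) and (z, 1, 1): even without normalisation, all values
  at 1 are governed by \<open>F 1 1\<close>, which is why 1 - F(1, 1) \<epsilon> is a two-sided
  unit.\<close>

lemma cocycle2_one:
  assumes "cocycle2 q F"
  shows "F 1 z = qmult q (F 1 1) z" "F z 1 = qmult q z (F 1 1)"
  using cocycle2D(4)[OF assms, of 1 1 z] cocycle2D(4)[OF assms, of z 1 1] by simp_all

lemma nf_wd_Nil: "nf q (wd []) = 1"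
  by (simp add: nf_single single_one[symmetric] del: single_one)

lemma nf_wd_Cons: "nf q (wd (i # w)) = qmult q (gen i) (nf q (wd w))"
  by (simp add: wd_Cons nf_mult nf_var)

lemma nf_wd_append: "nf q (wd (u @ v)) = qmult q (nf q (wd u)) (nf q (wd v))"
  by (induction u) (simp_all add: nf_wd_Nil nf_wd_Cons qmult_assoc)

text \<open>Concatenation becomes multiplication in the deformation: the empty word gives its unit,
  and the induction step is associativity, that is, the cocycle identity at the first letter, the
  rest of \<open>u\<close>, and \<open>v\<close>.\<close>

lemma lift_word_append:
  assumes "cocycle2 q F"
  shows "lift_word q F y (u @ v) = qmult q (nf q (wd u)) (lift_word q F y v)
    + qmult q (lift_word q F y u) (nf q (wd v)) + F (nf q (wd u)) (nf q (wd v))"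
proof (induction u)
  case Nil
  show ?case using cocycle2_one(1)[OF assms, of "nf q (wd v)"]
    by (simp add: nf_wd_Nil qmult_minus_left del: single_one)
next
  case (Cons i u)
  show ?case
    using Cons cocycle2D(4)[OF assms, of "gen i" "nf q (wd u)" "nf q (wd v)"]
    by (simp add: nf_wd_Cons nf_wd_append qmult_add_left qmult_add_right qmult_assoc algebra_simps)
qed

lemma hom_wt_nf_wd: "hom_wt size (length w) (nf q (wd w))"
  by (simp add: nf_single hom_wt_single)

lemma hom_wt_lift_word:
  assumes F: "cocycle2 q F" and y: "\<And>i. hom_wt size 1 (y i)"
  shows "hom_wt size (length w) (lift_word q F y w)"
proof (induction w)
  case Nil
  have "hom_wt size 0 (1 :: 'a multiset \<Rightarrow>\<^sub>0 'b)" by (simp add: hom_wt_def)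
  from cocycle2D(3)[OF F this this] show ?case by (simp add: hom_wt_minus)
next
  case (Cons i w)
  have g: "hom_wt size 1 (gen i :: 'a multiset \<Rightarrow>\<^sub>0 'b)" by (simp add: hom_wt_single)
  show ?case
    using hom_wt_qmult[OF g Cons, of q] hom_wt_qmult[OF y[of i] hom_wt_nf_wd[of w q], of q]
      cocycle2D(3)[OF F g hom_wt_nf_wd]
    by (simp add: hom_wt_add)
qed

text \<open>In the deformation by \<open>F\<close>, the elements \<open>x\<^sub>i + y\<^sub>i \<epsilon>\<close> satisfy the relations of the algebra,
  so the algebra maps to its deformation; the \<open>\<epsilon>\<close>-part of this section is the cochain.\<close>

lemma cocycle2_coboundaryI:
  fixes q :: "'n::{finite,linorder} \<times> 'n \<Rightarrow> 'r::comm_ring_1"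
  assumes F: "cocycle2 q F" and y: "\<And>i. hom_wt size 1 (y i)"
    and rel: "\<And>i j. i < j \<Longrightarrow> qmult q (gen j) (y i) + qmult q (y j) (gen i) + F (gen j) (gen i)
      = scal (q (i, j)) (qmult q (gen i) (y j) + qmult q (y i) (gen j) + F (gen i) (gen j))"
  obtains G where "hom_wt_map1 G" "F = hdiff1 q G"
proof -
  note lin = cocycle2D(1,2)[OF F]
  define H where "H = lin (\<lambda>w. lift_word q F y (letters w))"
  have linH: "klinear H" by (auto simp: H_def)
  \<comment> \<open>This makes p -> \<open>nf q p\<close> + \<open>H p\<close> \<epsilon> a
    homomorphism from the free algebra to the deformation.\<close>
  have Hmult: "H (p * r) = qmult q (nf q p) (H r) + qmult q (H p) (nf q r) + F (nf q p) (nf q r)"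
    for p r
  proof (rule klinear_ext2[where x = p and y = r and F = "\<lambda>p r. H (p * r)"])
    fix u v
    show "H (single u 1 * single v 1) = qmult q (nf q (single u 1)) (H (single v 1))
        + qmult q (H (single u 1)) (nf q (single v 1)) + F (nf q (single u 1)) (nf q (single v 1))"
      using lift_word_append[OF F, of y "letters u" "letters v"]
      by (simp add: H_def mult_single plus_word_def)
  qed (intro klinear_plus klinear_compose[OF linH klinear_mult_left]
      klinear_compose[OF linH klinear_mult_right] klinear_compose[OF klinear_qmult_left linH]
      klinear_compose[OF klinear_qmult_right linH] klinear_compose[OF klinear_qmult_left klinear_nf]
      klinear_compose[OF klinear_qmult_right klinear_nf] klinear_compose[OF lin(1) klinear_nf]
      klinear_compose[OF lin(2) klinear_nf])+
  have Hvar: "H (var i) = y i" for i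
    using cocycle2_one(2)[OF F, of "gen i"]
    by (simp add: H_def var_def nf_wd_Nil[simplified] qmult_minus_right nf_wd_Nil)
  \<comment> \<open>\<open>H\<close> alone obeys only a twisted product rule, so the ideal used is
    the kernel of both components together.\<close>
  have "qideal q \<subseteq> {p. nf q p = 0 \<and> H p = 0}"
  proof (rule qideal_minimal, rule ideal_free_algI)
    fix i j :: 'n assume ij: "i < j"
    have "H (var j * var i - const (q (i, j)) * var i * var j)
        = H (var j * var i) - scal (q (i, j)) (H (var i * var j))"
      by (simp add: klinear_diff[OF linH] klinear_scal[OF linH] const_mult scal_mult_left)
    also have "\<dots> = 0"
      using rel[OF ij] by (simp add: Hmult Hvar nf_var)
    finally show "var j * var i - const (q (i, j)) * var i * var j \<in> {p. nf q p = 0 \<and> H p = 0}"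
      using ij by (simp add: nf_relation)
  qed (auto simp: nf_add nf_mult Hmult klinear_add[OF linH] klinear_zero[OF linH]
      klinear_zero[OF lin(1)] klinear_zero[OF lin(2)])
  then have ker: "H p = 0" if "nf q p = 0" for p
    using that by (auto simp: qideal_eq_kernel)
  define G where "G x = H (sect x)" for x
  have HG: "H p = G (nf q p)" for p
    using ker[of "p - sect (nf q p)"] by (simp add: nf_diff klinear_diff[OF linH] G_def)
  have "G (qmult q x z) = qmult q x (G z) + qmult q (G x) z + F x z" for x z
    using HG[of "sect x * sect z"] Hmult[of "sect x" "sect z"] by (simp add: nf_mult G_def)
  moreover have linG: "klinear G"
    unfolding G_def[abs_def] by (rule klinear_compose[OF linH klinear_sect])
  \<comment> \<open>\<open>hdiff1\<close> carries a minus sign at the product, hence the cochain is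
    \<open>- G\<close>.\<close>
  ultimately have "F = hdiff1 q (\<lambda>x. - G x)"
    by (auto simp: hdiff1_def fun_eq_iff qmult_minus_left qmult_minus_right)
  moreover have "hom_wt_map1 (\<lambda>x. - G x)"
    unfolding hom_wt_map1_def
  proof (intro conjI allI impI klinear_uminus linG hom_wt_minus)
    fix d and x :: "'n multiset \<Rightarrow>\<^sub>0 'r" assume x: "hom_wt size d x"
    have "hom_wt (\<lambda>w. length (letters w)) d (sect x)"
      unfolding sect_def by (rule hom_wt_lin[OF x]) (simp add: hom_wt_single flip: size_mset)
    then show "hom_wt size d (G x)"
      unfolding G_def H_def by (rule hom_wt_lin) (auto intro: hom_wt_lift_word[OF F y])
  qed
  ultimately show ?thesis using that by blast
qed

section \<open>The overlap equations\<close>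

lemma lookup_gen_mult: "lookup (qmult q (gen k) x) p
    = (if k \<in># p then bichar q {#k#} (p - {#k#}) * lookup x (p - {#k#}) else 0)"
  by (rule additive_ext[where x = x and f = "\<lambda>x. lookup (qmult q (gen k) x) p"])
    (auto simp: qmult_add_right lookup_add algebra_simps qmult_single lookup_single when_def)

lemma lookup_mult_gen: "lookup (qmult q x (gen k)) p
    = (if k \<in># p then bichar q (p - {#k#}) {#k#} * lookup x (p - {#k#}) else 0)"
  by (rule additive_ext[where x = x and f = "\<lambda>x. lookup (qmult q x (gen k)) p"])
    (auto simp: qmult_add_left lookup_add algebra_simps qmult_single lookup_single when_def)

definition bch :: "('n::{finite,linorder} \<times> 'n \<Rightarrow> 'r) \<Rightarrow> 'n \<Rightarrow> 'n \<Rightarrow> 'r::comm_ring_1"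
  where "bch q i j = bichar q {#i#} {#j#}"

lemma bichar_pairs:
  "bichar q {#i#} {#j, k#} = bch q i j * bch q i k"
  "bichar q {#j, k#} {#i#} = bch q j i * bch q k i"
proof -
  have "{#j, k#} = {#j#} + {#k#}" by (simp add: add_mset_commute)
  then show "bichar q {#i#} {#j, k#} = bch q i j * bch q i k"
    and "bichar q {#j, k#} {#i#} = bch q j i * bch q k i"
    by (simp_all only: bichar_add_left bichar_add_right bch_def)
qed

text \<open>The \<epsilon>-part of x_j x_i - Q_ij x_i x_j in the deformation by \<open>F\<close>.
  With \<open>qmatrix\<close> in place of \<open>q\<close> it makes sense for both orders of the
  indices, so the overlap equations need no case distinction on the order of \<open>i\<close>,
  \<open>j\<close>, \<open>k\<close>.\<close>

definition obstr :: "('n::{finite,linorder} \<times> 'n \<Rightarrow> 'k::field) \<Rightarrow>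
    (('n multiset \<Rightarrow>\<^sub>0 'k) \<Rightarrow> ('n multiset \<Rightarrow>\<^sub>0 'k) \<Rightarrow> ('n multiset \<Rightarrow>\<^sub>0 'k)) \<Rightarrow>
    'n \<Rightarrow> 'n \<Rightarrow> ('n multiset \<Rightarrow>\<^sub>0 'k)"
  where "obstr q F i j = F (gen j) (gen i) - scal (qmatrix q i j) (F (gen i) (gen j))"

context
  fixes q :: "'n::{finite,linorder} \<times> 'n \<Rightarrow> 'k::field"
  assumes nz: "\<And>i j. i < j \<Longrightarrow> q (i, j) \<noteq> 0"
begin

lemma bch_nonzero: "bch q i j \<noteq> 0"
  using nz by (simp add: bch_def bichar_singles)

lemma qmatrix_inverse: "qmatrix q i j * qmatrix q j i = 1"
  using nz[of i j] nz[of j i] by (auto simp: qmatrix_def)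

lemma bch_commute: "bch q k i = qmatrix q i k * bch q i k"
  using nz[of k i] by (auto simp: bch_def bichar_singles qmatrix_def)

lemma bch_self: "bch q i i = 1"
  by (simp add: bch_def bichar_singles)

lemma gen_commute: "qmult q (gen k) (gen i) = scal (qmatrix q i k) (qmult q (gen i) (gen k))"
  using bch_commute[of k i] by (simp add: qmult_single bch_def add_mset_commute)

text \<open>Reversing x_k x_j x_i by adjacent swaps can begin with the right or the left pair. Both
  routes end at the same multiple of x_i x_j x_k, which cancels; each swap leaves behind one
  obstruction times the letter it did not touch.\<close>

lemma overlap:
  assumes F: "cocycle2 q F"
  shows "scal (qmatrix q i j * qmatrix q i k) (qmult q (gen i) (obstr q F j k))
      + scal (qmatrix q i j) (qmult q (obstr q F i k) (gen j)) + qmult q (gen k) (obstr q F i j)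
    = scal (qmatrix q j k * qmatrix q i k) (qmult q (obstr q F i j) (gen k))
      + scal (qmatrix q j k) (qmult q (gen j) (obstr q F i k)) + qmult q (obstr q F j k) (gen i)"
proof -
  note lin = cocycle2D(1,2)[OF F]
  \<comment> \<open>the \<open>\<epsilon>\<close>-part of \<open>x\<^sub>a x\<^sub>b x\<^sub>c\<close> in the deformation by \<open>F\<close>\<close>
  define T where "T a b c = F (qmult q (gen a) (gen b)) (gen c) + qmult q (F (gen a) (gen b)) (gen c)"
    for a b c
  have F_gens: "F (gen b) (gen a) = obstr q F a b + scal (qmatrix q a b) (F (gen a) (gen b))" for a b
    by (simp add: obstr_def)
  have swap1: "T b a c = scal (qmatrix q a b) (T a b c) + qmult q (obstr q F a b) (gen c)" for a b c
    unfolding T_def gen_commute[of b a] F_gens[of b a]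
    by (simp add: klinear_scal[OF lin(2)] qmult_add_left qmult_scal_left scal_add_right)
  \<comment> \<open>Associativity: this bracketing serves the swap of the last two letters, the
    defining one that of the first two.\<close>
  have T': "T a b c = qmult q (gen a) (F (gen b) (gen c)) + F (gen a) (qmult q (gen b) (gen c))" for a b c
    by (simp add: T_def cocycle2D(4)[OF F])
  have swap2: "T a c b = scal (qmatrix q b c) (T a b c) + qmult q (gen a) (obstr q F b c)" for a b c
    unfolding T' gen_commute[of c b] F_gens[of c b]
    by (simp add: klinear_scal[OF lin(1)] qmult_add_right qmult_scal_right scal_add_right)
  have "T k j i = scal (qmatrix q i j) (scal (qmatrix q i k) (scal (qmatrix q j k) (T i j k)
      + qmult q (gen i) (obstr q F j k)) + qmult q (obstr q F i k) (gen j)) + qmult q (gen k) (obstr q F i j)"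
    by (simp only: swap2[of k j i] swap1[of k i j] swap2[of i k j])
  moreover have "T k j i = scal (qmatrix q j k) (scal (qmatrix q i k) (scal (qmatrix q i j) (T i j k)
      + qmult q (obstr q F i j) (gen k)) + qmult q (gen j) (obstr q F i k)) + qmult q (obstr q F j k) (gen i)"
    by (simp only: swap1[of k j i] swap2[of j k i] swap1[of j i k])
  ultimately show ?thesis
    by (simp add: scal_add_right ac_simps)
qed

lemma obstr_flip: "obstr q F j i = - scal (qmatrix q j i) (obstr q F i j)"
  by (simp add: obstr_def scal_diff_right qmatrix_inverse)

lemma hom_wt_obstr:
  assumes F: "cocycle2 q F"
  shows "hom_wt size 2 (obstr q F i j)"
proof -
  have g: "hom_wt size 1 (gen i :: 'n multiset \<Rightarrow>\<^sub>0 'k)" for i by (simp add: hom_wt_single)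
  show ?thesis
    using cocycle2D(3)[OF F g g] by (simp add: obstr_def hom_wt_diff hom_wt_scal numeral_2_eq_2)
qed

text \<open>The coefficient of \<open>x\<^sup>n\<close> in \<open>obstr q F i j\<close> has weight \<open>n - e\<^sub>i - e\<^sub>j\<close>. If this is \<open>-1\<close> at
  \<open>i\<close> and \<open>j\<close>, then in the overlap of \<open>x\<^sub>i\<close>, \<open>x\<^sub>j\<close> and \<open>x\<^sub>a\<close> the monomial \<open>x\<^sup>n x\<^sub>a\<close> meets no other
  obstruction.\<close>

lemma obstr_lookup_disjoint:
  assumes F: "cocycle2 q F" and "a \<noteq> i" "a \<noteq> j" "b \<noteq> i" "b \<noteq> j"
    and gen: "qmatrix q a i * qmatrix q a j \<noteq> qmatrix q a b"
  shows "lookup (obstr q F i j) {#a, b#} = 0"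
proof -
  let ?r = "lookup (obstr q F i j) {#a, b#}"
  have "bichar q {#a#} {#a, b#} * ?r
      = qmatrix q j a * qmatrix q i a * (bichar q {#a, b#} {#a#} * ?r)"
    using arg_cong[OF overlap[OF F, of i j a], of "\<lambda>x. lookup x {#a, a, b#}"] assms(2-5)
    by (simp add: lookup_add lookup_gen_mult lookup_mult_gen)
  then have "(1 - qmatrix q j a * qmatrix q i a * qmatrix q a b) * bch q a b * ?r = 0"
    by (simp add: bichar_pairs bch_self bch_commute[of b a] algebra_simps)
  \<comment> \<open>Multiplied by \<open>qmatrix q a i * qmatrix q a j\<close>, the equality would
    become the one excluded by \<open>gen\<close>.\<close>
  moreover have "qmatrix q j a * qmatrix q i a * qmatrix q a b \<noteq> 1"
  proof
    assume "qmatrix q j a * qmatrix q i a * qmatrix q a b = 1"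
    moreover have "(qmatrix q a i * qmatrix q i a) * (qmatrix q a j * qmatrix q j a) * qmatrix q a b
        = qmatrix q a i * qmatrix q a j * (qmatrix q j a * qmatrix q i a * qmatrix q a b)"
      by (simp only: ac_simps)
    ultimately show False using gen by (simp add: qmatrix_inverse)
  qed
  ultimately show ?thesis using bch_nonzero by simp
qed

text \<open>Weights with a single entry \<open>-1\<close>, at \<open>j\<close>: the coefficients are proportional to those of the
  obstruction created by replacing \<open>x\<^sub>j\<close> with \<open>x\<^sub>j + t x\<^sub>a \<epsilon>\<close>.\<close>

lemma obstr_lookup_proportional:
  assumes F: "cocycle2 q F" and "i \<noteq> j" "k \<noteq> j" "a \<noteq> j"
  shows "lookup (obstr q F i j) {#i, a#} * bch q k a * (qmatrix q k j - qmatrix q k a)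
    = lookup (obstr q F k j) {#k, a#} * bch q i a * (qmatrix q i j - qmatrix q i a)"
proof -
  let ?r = "lookup (obstr q F i j) {#i, a#}" and ?s = "lookup (obstr q F k j) {#k, a#}"
  have "lookup (obstr q F j k) {#k, a#} = - (qmatrix q j k * ?s)"
    by (simp add: obstr_flip[of F j k])
  \<comment> \<open>The coefficient of x_i x_k x_a in the overlap: both terms with
    \<open>obstr q F i k\<close> carry a factor x_j, which this monomial lacks.\<close>
  moreover have "qmatrix q i j * qmatrix q i k * (bichar q {#i#} {#k, a#} * lookup (obstr q F j k) {#k, a#})
      + bichar q {#k#} {#i, a#} * ?r
    = qmatrix q j k * qmatrix q i k * (bichar q {#i, a#} {#k#} * ?r)
      + bichar q {#k, a#} {#i#} * lookup (obstr q F j k) {#k, a#}"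
    using arg_cong[OF overlap[OF F, of i j k], of "\<lambda>x. lookup x {#i, k, a#}"] assms(2-4)
    by (simp add: lookup_add lookup_gen_mult lookup_mult_gen add_mset_commute)
  ultimately have "qmatrix q i k * bch q i k * (?r * bch q k a * (1 - qmatrix q j k * qmatrix q k a))
      = qmatrix q i k * bch q i k * (qmatrix q j k * ?s * bch q i a * (qmatrix q i j - qmatrix q i a))"
    by (simp add: bichar_pairs bch_commute[of k i] bch_commute[of a k] bch_commute[of a i] algebra_simps)
  moreover have "qmatrix q i k * bch q i k \<noteq> 0"
    using bch_commute[of k i] bch_nonzero[of k i] by simp
  ultimately have "?r * bch q k a * (1 - qmatrix q j k * qmatrix q k a)
      = qmatrix q j k * ?s * bch q i a * (qmatrix q i j - qmatrix q i a)"
    by (metis mult_left_cancel)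
  then have "qmatrix q k j * (?r * bch q k a * (1 - qmatrix q j k * qmatrix q k a))
      = (qmatrix q k j * qmatrix q j k) * (?s * bch q i a * (qmatrix q i j - qmatrix q i a))"
    by (simp add: mult.assoc)
  moreover have "qmatrix q k j * (?r * bch q k a * (1 - qmatrix q j k * qmatrix q k a))
      = ?r * bch q k a * (qmatrix q k j - (qmatrix q k j * qmatrix q j k) * qmatrix q k a)"
    by (simp add: algebra_simps)
  ultimately show ?thesis by (simp add: qmatrix_inverse mult.assoc)
qed

text \<open>One index \<open>k\<close> with Q_kj /= Q_ka fixes \<open>t\<close>, and proportionality
  carries it to every \<open>i\<close>. The factor of \<open>t\<close> is minus the coefficient of
  x_i x_a that the substitution x_j -> x_j + x_a \<epsilon> creates in x_j x_i - Q_ij x_i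
  x_j.\<close>

lemma obstr_lookup_correction:
  assumes F: "cocycle2 q F" and "a \<noteq> j"
    and gen: "\<exists>i. i \<noteq> j \<and> qmatrix q i j \<noteq> qmatrix q i a"
  shows "\<exists>t. \<forall>i. i \<noteq> j \<longrightarrow>
    lookup (obstr q F i j) {#i, a#} = t * (qmatrix q i j - qmatrix q i a) * bch q i a"
proof -
  obtain k where k: "k \<noteq> j" "qmatrix q k j - qmatrix q k a \<noteq> 0" using gen by auto
  define c where "c = bch q k a * (qmatrix q k j - qmatrix q k a)"
  have "c \<noteq> 0" using k bch_nonzero by (simp add: c_def)
  have "lookup (obstr q F i j) {#i, a#}
      = lookup (obstr q F k j) {#k, a#} / c * (qmatrix q i j - qmatrix q i a) * bch q i a"
    if "i \<noteq> j" for i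
    using obstr_lookup_proportional[OF F that k(1) assms(2)] \<open>c \<noteq> 0\<close>
    by (simp add: c_def field_simps)
  then show ?thesis by blast
qed

text \<open>Genericity enters through two conditions that make sense for any number of variables;
  \<open>gen3\<close> says that columns \<open>a\<close> and \<open>j\<close> of the matrix differ
  in some row other than \<open>j\<close>.\<close>

theorem cocycle2_cohomologous_kscoc:
  assumes F: "cocycle2 q F"
    and gen2: "\<And>a b i j. a \<le> b \<Longrightarrow> i < j \<Longrightarrow> {i, j} \<inter> {a, b} = {} \<Longrightarrow>
      qmatrix q a i * qmatrix q a j \<noteq> qmatrix q a b"
    and gen3: "\<And>j a. a \<noteq> j \<Longrightarrow> \<exists>i. i \<noteq> j \<and> qmatrix q i j \<noteq> qmatrix q i a"
  obtains \<alpha> G where "\<alpha> \<in> tangent_space" "hom_wt_map1 G" "F = (\<lambda>x y. hdiff1 q G x y + kscoc q \<alpha> x y)"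
proof -
  define r where "r = obstr q F"
  have "\<forall>j a. \<exists>t. a \<noteq> j \<longrightarrow> (\<forall>i. i \<noteq> j \<longrightarrow>
      lookup (r i j) {#i, a#} = t * (qmatrix q i j - qmatrix q i a) * bch q i a)"
    using obstr_lookup_correction[OF F _ gen3] unfolding r_def by blast
  then obtain t where t: "\<And>i j a. a \<noteq> j \<Longrightarrow> i \<noteq> j \<Longrightarrow>
      lookup (r i j) {#i, a#} = t j a * (qmatrix q i j - qmatrix q i a) * bch q i a"
    by metis
  \<comment> \<open>All substitutions of x_j at once. The term a = j is left out because rescaling
    x_j preserves the relations.\<close>
  define y where "y j = (\<Sum>a\<in>UNIV - {j}. single {#a#} (t j a))" for j
  have y1: "hom_wt size 1 (y j)" for j
    unfolding y_def by (intro hom_wt_sum) (simp add: hom_wt_single)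
  have lookup_y: "lookup (y j) {#a#} = (if a = j then 0 else t j a)" for j a
    by (simp add: y_def lookup_sum lookup_single when_def)
  \<comment> \<open>By \<open>kscoc_gens\<close>, subtracting \<open>kscoc q \<alpha>\<close>
    removes exactly the coefficient of x_i x_j; the restriction to \<open>index_pairs\<close> makes
    \<alpha> extensional.\<close>
  define \<alpha> where "\<alpha> = (\<lambda>(i, j)\<in>index_pairs. lookup (r i j) {#i, j#})"
  have "\<alpha> \<in> tangent_space" by (simp add: \<alpha>_def tangent_space_def)
  define F' where "F' x z = F x z - kscoc q \<alpha> x z" for x z
  have F': "cocycle2 q F'"
    unfolding F'_def[abs_def] by (intro cocycle2_diff F cocycle2_kscoc)
  have rel: "qmult q (gen j) (y i) + qmult q (y j) (gen i) + F' (gen j) (gen i)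
      = scal (q (i, j)) (qmult q (gen i) (y j) + qmult q (y i) (gen j) + F' (gen i) (gen j))"
    if ij: "i < j" for i j
  proof -
    have Q: "q (i, j) = qmatrix q i j" using ij by (simp add: qmatrix_def)
    have "i \<noteq> j" using ij by simp
    \<comment> \<open>The \<epsilon>-part of the relation evaluated at x_i + y_i \<epsilon> and x_j
      + y_j \<epsilon> in the deformation by \<open>F'\<close>; it is shown to vanish monomial by
      monomial.\<close>
    define E where "E = r i j - single {#i, j#} (\<alpha> (i, j))
      + (qmult q (gen j) (y i) - scal (qmatrix q i j) (qmult q (y i) (gen j)))
      + (qmult q (y j) (gen i) - scal (qmatrix q i j) (qmult q (gen i) (y j)))"
    have "lookup E n = 0" for n
    proof (cases "size n = 2")
      case False
      have g: "hom_wt size 1 (gen i :: 'n multiset \<Rightarrow>\<^sub>0 'k)" for i by (simp add: hom_wt_single)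
      have "hom_wt size 2 E"
        unfolding E_def r_def
        using hom_wt_qmult[OF g y1] hom_wt_qmult[OF y1 g]
        by (intro hom_wt_add hom_wt_diff hom_wt_scal hom_wt_obstr F)
          (simp_all add: hom_wt_single numeral_2_eq_2)
      then show ?thesis using False by (auto simp: hom_wt_alt)
    next
      case True
      have rest: "\<exists>a. n = {#c, a#}" if "c \<in># n" for c
        using True multi_member_split[OF that] by (auto simp: size_1_singleton_mset)
      consider "i \<notin># n" "j \<notin># n" | a where "n = {#i, a#}" | a where "n = {#j, a#}" "a \<noteq> i"
        using rest[of i] rest[of j] by (metis insertI1 set_mset_add_mset_insert insertCI)
      then show ?thesis
      proof cases
        case 1
        obtain c d where "n = {#c, d#}"
          using True rest multiset_nonemptyE[of n] by (metis size_empty zero_neq_numeral)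
        \<comment> \<open>The monomial is symmetric in its letters, whereas \<open>gen2\<close>
          expects them in order.\<close>
        then obtain a b where ab: "n = {#a, b#}" "a \<le> b"
          by (metis add_mset_commute linear)
        then have "a \<noteq> i" "a \<noteq> j" "b \<noteq> i" "b \<noteq> j" using 1 by auto
        then have "lookup (r i j) n = 0"
          using obstr_lookup_disjoint[OF F, of a i j b] gen2[OF ab(2) ij] by (simp add: r_def ab(1))
        then show ?thesis using 1
          by (auto simp: E_def lookup_add lookup_minus lookup_single lookup_gen_mult lookup_mult_gen when_def)
      next
        case (2 a)
        show ?thesis
        proof (cases "a = j")
          \<comment> \<open>At x_i x_j the substitutions contribute nothing, since y_i has no x_i
            and y_j no x_j; \<alpha> was chosen to cancel the rest.\<close>
          case True
          then show ?thesis using \<open>i \<noteq> j\<close> ij 2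
            by (simp add: E_def lookup_add lookup_minus lookup_gen_mult lookup_mult_gen lookup_y \<alpha>_def
                index_pairs_def)
        next
          case False
          then show ?thesis using \<open>i \<noteq> j\<close> 2 bch_commute[of a i]
            by (simp add: E_def lookup_add lookup_minus lookup_gen_mult lookup_mult_gen lookup_y t
                lookup_single_not_eq algebra_simps flip: bch_def)
        qed
      next
        case (3 a)
        \<comment> \<open>Now x_i is the variable being corrected, so the coefficient is taken from
          \<open>r j i\<close> and carried over by \<open>obstr_flip\<close>.\<close>
        then have "lookup (r i j) n = - (qmatrix q i j * (t i a * (qmatrix q j i - qmatrix q j a) * bch q j a))"
          using \<open>i \<noteq> j\<close> obstr_flip[of F i j] t[of a i j] by (simp add: r_def)
        also have "\<dots> = - (t i a * ((qmatrix q i j * qmatrix q j i) - qmatrix q i j * qmatrix q j a) * bch q j a)"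
          by (simp add: algebra_simps)
        finally show ?thesis using \<open>i \<noteq> j\<close> 3 bch_commute[of a j]
          by (simp add: E_def lookup_add lookup_minus lookup_gen_mult lookup_mult_gen lookup_y
              lookup_single_not_eq qmatrix_inverse algebra_simps flip: bch_def)
      qed
    qed
    then have "E = 0" by (intro poly_mapping_eqI) simp
    moreover have "qmult q (gen j) (y i) + qmult q (y j) (gen i) + F' (gen j) (gen i)
      - scal (q (i, j)) (qmult q (gen i) (y j) + qmult q (y i) (gen j) + F' (gen i) (gen j)) = E"
      using kscoc_gens[OF ij, of q \<alpha>]
      by (simp add: E_def F'_def r_def obstr_def Q scal_add_right scal_diff_right)
    ultimately show ?thesis by simp
  qed
  obtain G where "hom_wt_map1 G" "F' = hdiff1 q G"
    by (rule cocycle2_coboundaryI[OF F' y1 rel])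
  then have "F = (\<lambda>x y. hdiff1 q G x y + kscoc q \<alpha> x y)"
    by (metis (no_types, lifting) ext F'_def diff_add_cancel)
  with \<open>\<alpha> \<in> tangent_space\<close> \<open>hom_wt_map1 G\<close> show ?thesis using that by blast
qed

text \<open>In the obstruction of a coboundary, only the x_i-part of \<open>G (gen i)\<close> and
  the x_j-part of \<open>G (gen j)\<close> reach the monomial x_i x_j. These rescale the variables,
  which preserves the relation, so their contributions cancel.\<close>

lemma kscoc_cohomologous_imp_eq:
  assumes G: "hom_wt_map1 G" and eq: "\<And>x y. kscoc q \<alpha> x y = hdiff1 q G x y + kscoc q \<beta> x y"
    and ij: "i < j"
  shows "\<alpha> (i, j) = \<beta> (i, j)"
proof -
  have lin: "klinear G" using G by (simp add: hom_wt_map1_def)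
  have "single {#i, j#} (\<alpha> (i, j)) = hdiff1 q G (gen j) (gen i) + single {#i, j#} (\<beta> (i, j))"
    using eq[of "gen j" "gen i"] kscoc_gens[OF ij] by metis
  then have a: "\<alpha> (i, j) = lookup (hdiff1 q G (gen j) (gen i)) {#i, j#} + \<beta> (i, j)"
    by (metis lookup_add lookup_single_eq)
  have b: "hdiff1 q G (gen i) (gen j) = 0"
    using eq[of "gen i" "gen j"] kscoc_gens[OF ij] by (metis add.right_neutral)
  \<comment> \<open>Subtracting a multiple of the vanishing value \<open>b\<close> removes the terms
    with \<open>G\<close> of a product, leaving only values of \<open>G\<close> on
    generators.\<close>
  have "hdiff1 q G (gen j) (gen i) - scal (qmatrix q i j) (hdiff1 q G (gen i) (gen j))
      = qmult q (gen j) (G (gen i)) + qmult q (G (gen j)) (gen i)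
        - scal (qmatrix q i j) (qmult q (gen i) (G (gen j)) + qmult q (G (gen i)) (gen j))"
    by (simp add: hdiff1_def gen_commute[of j i] klinear_scal[OF lin] scal_add_right scal_diff_right)
  then have E: "hdiff1 q G (gen j) (gen i) = qmult q (gen j) (G (gen i)) + qmult q (G (gen j)) (gen i)
        - scal (qmatrix q i j) (qmult q (gen i) (G (gen j)) + qmult q (G (gen i)) (gen j))"
    by (simp add: b)
  have "lookup (hdiff1 q G (gen j) (gen i)) {#i, j#} = 0"
    unfolding E using ij bch_commute[of j i]
    by (simp add: lookup_add lookup_minus lookup_gen_mult lookup_mult_gen algebra_simps flip: bch_def)
  with a show ?thesis by simp
qed

end

section \<open>Injectivity and surjectivity on cohomology\<close>

lemma hom_wt_map1_zero: "hom_wt_map1 (\<lambda>_. 0)"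
  by (simp add: hom_wt_map1_def klinear_def)

lemma hdiff1_zero: "hdiff1 q (\<lambda>_. 0) = (\<lambda>_ _. 0)"
  by (simp add: hdiff1_def fun_eq_iff)

lemma coh_class_cohomologous:
  assumes G: "hom_wt_map1 G"
  shows "coh_class q (\<lambda>x y. hdiff1 q G x y + F x y) = coh_class q F"
proof
  show "coh_class q (\<lambda>x y. hdiff1 q G x y + F x y) \<subseteq> coh_class q F"
  proof
    fix f assume "f \<in> coh_class q (\<lambda>x y. hdiff1 q G x y + F x y)"
    then obtain G' where G': "hom_wt_map1 G'"
      and f: "f = coch2 q (\<lambda>x y. hdiff1 q G' x y + (hdiff1 q G x y + F x y))"
      by (auto simp: coh_class_def)
    have "f = coch2 q (\<lambda>x y. hdiff1 q (\<lambda>x. G' x + G x) x y + F x y)"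
      by (simp add: f hdiff1_def qmult_add_left qmult_add_right algebra_simps)
    moreover have "hom_wt_map1 (\<lambda>x. G' x + G x)"
      using G G' by (simp add: hom_wt_map1_def klinear_plus hom_wt_add)
    ultimately show "f \<in> coh_class q F" unfolding coh_class_def by blast
  qed
  show "coh_class q F \<subseteq> coh_class q (\<lambda>x y. hdiff1 q G x y + F x y)"
  proof
    fix f assume "f \<in> coh_class q F"
    then obtain G' where G': "hom_wt_map1 G'" and f: "f = coch2 q (\<lambda>x y. hdiff1 q G' x y + F x y)"
      by (auto simp: coh_class_def)
    have "f = coch2 q (\<lambda>x y. hdiff1 q (\<lambda>x. G' x - G x) x y + (hdiff1 q G x y + F x y))"
      by (simp add: f hdiff1_def qmult_diff_left qmult_diff_right algebra_simps)
    moreover have "hom_wt_map1 (\<lambda>x. G' x - G x)"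
      using G G' by (simp add: hom_wt_map1_def klinear_subtract hom_wt_diff)
    ultimately show "f \<in> coh_class q (\<lambda>x y. hdiff1 q G x y + F x y)"
      unfolding coh_class_def by blast
  qed
qed

theorem proposition3p8:
  fixes q :: "4 \<times> 4 \<Rightarrow> 'k::{alg_closed_field, field_char_0}"
  assumes "q \<in> parameter_space"
    and "generic (qmatrix q)"
  shows "inj_on (kodaira_spencer q) tangent_space \<and>
    kodaira_spencer q ` tangent_space = carrier (HH_graded (qpoly q) 2)"
proof
  have nz: "q (i, j) \<noteq> 0" if "i < j" for i j
    using assms(1) that by (auto simp: parameter_space_def index_pairs_def PiE_iff)
  show "inj_on (kodaira_spencer q) tangent_space"
  proof (rule inj_onI)
    fix \<alpha> \<beta> :: "4 \<times> 4 \<Rightarrow> 'k"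
    assume \<alpha>: "\<alpha> \<in> tangent_space" and \<beta>: "\<beta> \<in> tangent_space"
      and "kodaira_spencer q \<alpha> = kodaira_spencer q \<beta>"
    moreover have "coch2 q (kscoc q \<alpha>) \<in> coh_class q (kscoc q \<alpha>)"
      unfolding coh_class_def using hom_wt_map1_zero
      by (intro CollectI exI[of _ "\<lambda>_. 0"]) (simp add: hdiff1_zero)
    ultimately have "coch2 q (kscoc q \<alpha>) \<in> coh_class q (kscoc q \<beta>)"
      by (simp add: kodaira_spencer_eq_coh_class)
    then obtain G where G: "hom_wt_map1 G"
      and "kscoc q \<alpha> = (\<lambda>x y. hdiff1 q G x y + kscoc q \<beta> x y)"
      by (auto simp: coh_class_def coch2_eq_iff)
    then have "kscoc q \<alpha> x y = hdiff1 q G x y + kscoc q \<beta> x y" for x y by simp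
    from kscoc_cohomologous_imp_eq[OF nz G this] have "\<alpha> ij = \<beta> ij" if "ij \<in> index_pairs" for ij
      using that by (auto simp: index_pairs_def)
    then show "\<alpha> = \<beta>"
      using \<alpha> \<beta> unfolding tangent_space_def by (intro PiE_ext)
  qed
  have gen2: "qmatrix q a i * qmatrix q a j \<noteq> qmatrix q a b"
    if "a \<le> b" "i < j" "{i, j} \<inter> {a, b} = {}" for a b i j
    using assms(2) that unfolding generic_def by blast
  have gen3: "\<exists>i. i \<noteq> j \<and> qmatrix q i j \<noteq> qmatrix q i a" if "a \<noteq> j" for j a
  proof -
    \<comment> \<open>Two indices \<open>i\<close>, \<open>k\<close> remain besides \<open>a\<close>
      and \<open>j\<close>. The last genericity condition, applied to the rows \<open>i\<close>,
      \<open>k\<close> and \<open>a\<close>, yields a row other than \<open>j\<close> in which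
      columns \<open>j\<close> and \<open>a\<close> differ.\<close>
    have "card (UNIV - {a, j}) = 2" using that by (simp add: card_Diff_subset)
    then obtain i k where "UNIV - {a, j} = {i, k}" "i \<noteq> k" by (auto simp: card_2_iff)
    then have "i \<notin> {a, j}" "k \<notin> {a, j}" by blast+
    then have "distinct [i, k, a, j]" using that \<open>i \<noteq> k\<close> by auto
    then have "\<not> (qmatrix q i j = qmatrix q i a \<and> qmatrix q k j = qmatrix q k a
        \<and> qmatrix q a j = qmatrix q a a)"
      using assms(2) unfolding generic_def by blast
    then show ?thesis using \<open>distinct [i, k, a, j]\<close> by auto
  qed
  show "kodaira_spencer q ` tangent_space = carrier (HH_graded (qpoly q) 2)"
  proof
    show "kodaira_spencer q ` tangent_space \<subseteq> carrier (HH_graded (qpoly q) 2)"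
      by (auto simp: kodaira_spencer_eq_coh_class carrier_HH_graded cocycle2_kscoc)
    show "carrier (HH_graded (qpoly q) 2) \<subseteq> kodaira_spencer q ` tangent_space"
    proof
      fix c assume "c \<in> carrier (HH_graded (qpoly q) 2)"
      then obtain F where F: "cocycle2 q F" "c = coh_class q F" by (auto simp: carrier_HH_graded)
      obtain \<alpha> G where "\<alpha> \<in> tangent_space" "hom_wt_map1 G"
        "F = (\<lambda>x y. hdiff1 q G x y + kscoc q \<alpha> x y)"
        by (rule cocycle2_cohomologous_kscoc[OF nz F(1) gen2 gen3])
      then show "c \<in> kodaira_spencer q ` tangent_space"
        by (simp add: F(2) coh_class_cohomologous kodaira_spencer_eq_coh_class)
    qed
  qed
qed

end
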